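(* Let $q_1,q_2$ be distinct primes with $q_1\equiv q_2\equiv 3\pmod 4$ and let $K=\mathbb{Q}(\sqrt{q_1},\sqrt{q_2})$. Let $\epsilon_1,\epsilon_2,\epsilon_3$ be the fundamental units of $\mathbb{Q}(\sqrt{q_1})$, $\mathbb{Q}(\sqrt{q_2})$, $\mathbb{Q}(\sqrt{q_1q_2})$, respectively. Then $\sqrt{\epsilon_1\epsilon_2}$ and $\sqrt{\epsilon_3}$ lie in $K$ and $\{\sqrt{\epsilon_1\epsilon_2},\sqrt{\epsilon_3},\epsilon_2\}$ is a set of fundamental units for $K$. Furthermore: (1) if $q_1\equiv q_2\equiv 3\pmod 8$, the unit signature rank of $K$ is $3$, i.e. $K$ has deficiency $1$; (2) if $q_1\equiv q_2\equiv 7\pmod 8$, the unit signature rank of $K$ is $2$, i.e. $K$ has deficiency $2$; (3) if $q_1\equiv 7\pmod 8$ and $q_2\equiv 3\pmod 8$, then the unit signature rank of $K$ is $3$ and the deficiency is $1$ if the Legendre symbol $(q_1/q_2)=+1$, while the unit signature rank and the deficiency are both equal to $2$ if $(q_1/q_2)=-1$.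
   Context: For a totally real field $F$ of degree $n$ and $0\neq\alpha\in F$, the signature of $\alpha$ is the vector in $\mathbb{F}_2^n$ whose entry at a real embedding $v$ is $0$ if $v(\alpha)>0$ and $1$ if $v(\alpha)<0$. The signatures of the units of $F$ form a subspace of $\mathbb{F}_2^n$; its dimension is the unit signature rank of $F$, and the deficiency of $F$ is $n$ minus the unit signature rank. *)

theory Defs
  imports "HOL-Computational_Algebra.Polynomial" "HOL-Library.Z2" "HOL-Number_Theory.Number_Theory"
begin

definition quad_field :: "real \<Rightarrow> real set" where
  "quad_field d = {a + b * sqrt d | a b. a \<in> \<rat> \<and> b \<in> \<rat>}"

definition biquad_field :: "real \<Rightarrow> real \<Rightarrow> real set" where
  "biquad_field d1 d2 =
     {a + b * sqrt d1 + c * sqrt d2 + e * sqrt (d1 * d2) | a b c e.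
        a \<in> \<rat> \<and> b \<in> \<rat> \<and> c \<in> \<rat> \<and> e \<in> \<rat>}"

definition ring_of_integers :: "real set \<Rightarrow> real set" where
  "ring_of_integers K = {x \<in> K. algebraic_int x}"

definition units_of_field :: "real set \<Rightarrow> real set" where
  "units_of_field K = {u \<in> ring_of_integers K. u \<noteq> 0 \<and> inverse u \<in> ring_of_integers K}"

definition roots_of_unity_in :: "real set \<Rightarrow> real set" where
  "roots_of_unity_in K = {z \<in> K. \<exists>n::nat. n > 0 \<and> z ^ n = 1}"

definition is_fundamental_unit :: "real \<Rightarrow> real \<Rightarrow> bool" where
  "is_fundamental_unit d e \<longleftrightarrow>
     e \<in> units_of_field (quad_field d) \<and> e > 1 \<and>
     (\<forall>u \<in> units_of_field (quad_field d). u > 1 \<longrightarrow> e \<le> u)"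

definition is_fundamental_system :: "real set \<Rightarrow> real list \<Rightarrow> bool" where
  "is_fundamental_system K etas \<longleftrightarrow>
     set etas \<subseteq> units_of_field K \<and>
     (\<forall>u \<in> units_of_field K. \<exists>!(z, ks). z \<in> roots_of_unity_in K \<and> length ks = length etas \<and>
         u = z * prod_list (map2 (\<lambda>e k. e powi k) etas ks))"

text \<open>Real embeddings of K: ring homomorphisms K \<rightarrow> R (extended by 0 outside K so that
  they are determined by their values on K).\<close>

definition real_embeddings :: "real set \<Rightarrow> (real \<Rightarrow> real) set" where
  "real_embeddings K = {\<sigma>.
     (\<forall>x \<in> K. \<forall>y \<in> K. \<sigma> (x + y) = \<sigma> x + \<sigma> y \<and> \<sigma> (x * y) = \<sigma> x * \<sigma> y) \<and>
     \<sigma> 1 = 1 \<and> (\<forall>x. x \<notin> K \<longrightarrow> \<sigma> x = 0)}"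

definition signature :: "real set \<Rightarrow> real \<Rightarrow> (real \<Rightarrow> real) \<Rightarrow> bit" where
  "signature K \<alpha> = (\<lambda>\<sigma>. if \<sigma> \<in> real_embeddings K \<and> \<sigma> \<alpha> < 0 then 1 else 0)"

definition f2_independent :: "'e set \<Rightarrow> nat \<Rightarrow> (nat \<Rightarrow> 'e \<Rightarrow> bit) \<Rightarrow> bool" where
  "f2_independent E r v \<longleftrightarrow>
     (\<forall>c :: nat \<Rightarrow> bit. (\<forall>x \<in> E. (\<Sum>i<r. c i * v i x) = 0) \<longrightarrow> (\<forall>i<r. c i = 0))"

definition f2_dim :: "'e set \<Rightarrow> ('e \<Rightarrow> bit) set \<Rightarrow> nat" where
  "f2_dim E S = Max {r. \<exists>v. (\<forall>i<r. v i \<in> S) \<and> f2_independent E r v}"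

definition unit_signature_rank :: "real set \<Rightarrow> nat" where
  "unit_signature_rank K =
     f2_dim (real_embeddings K) (signature K ` units_of_field K)"

definition deficiency :: "real set \<Rightarrow> nat" where
  "deficiency K = card (real_embeddings K) - unit_signature_rank K"

end

theory Submission
  imports
    "Jordan_Normal_Form.Char_Poly"
    Defs
    "HOL-Computational_Algebra.Squarefree"
    "HOL-Computational_Algebra.Nth_Powers"
    "HOL-Library.FuncSet"
begin

text \<open>
  Factoring the Pell equation of a fundamental unit writes
  \<open>\<epsilon>\<^sub>i = (r\<^sub>i + t\<^sub>i \<surd>q\<^sub>i)\<^sup>2 / 2\<close> with \<open>r\<^sub>i\<^sup>2 - q\<^sub>i t\<^sub>i\<^sup>2 = \<plusminus>2\<close> for \<open>i = 1, 2\<close> and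
  \<open>\<epsilon>\<^sub>3 = ((r\<^sub>3 \<surd>q\<^sub>1 + t\<^sub>3 \<surd>q\<^sub>2) / 2)\<^sup>2\<close> with \<open>q\<^sub>1 r\<^sub>3\<^sup>2 - q\<^sub>2 t\<^sub>3\<^sup>2 = \<plusminus>4\<close>, so both square roots lie in \<open>K\<close>.
  The square of a unit of \<open>K\<close> is a product of conjugates of its relative norms to the quadratic
  subfields, hence up to sign a product of powers of the \<open>\<epsilon>\<^sub>i\<close>. Dividing by powers of
  \<open>\<surd>(\<epsilon>\<^sub>1 \<epsilon>\<^sub>2)\<close> and \<open>\<surd>\<epsilon>\<^sub>3\<close> leaves a unit whose square is a power of \<open>\<epsilon>\<^sub>2\<close>; the exponent is even,
  since otherwise \<open>\<epsilon>\<^sub>2\<close>, and therefore \<open>2\<close>, would be a square in \<open>K\<close>. The sign vectors of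
  \<open>-1\<close>, \<open>\<surd>(\<epsilon>\<^sub>1 \<epsilon>\<^sub>2)\<close> and \<open>\<surd>\<epsilon>\<^sub>3\<close> are determined by the signs in the three norm equations, which are
  governed by \<open>q\<^sub>1\<close>, \<open>q\<^sub>2\<close> modulo \<open>8\<close> and by the Legendre symbol, and \<open>\<epsilon>\<^sub>2\<close> is totally positive.
\<close>

section \<open>Closure properties of algebraic integers\<close>

text \<open>Determinant trick: the vector of the \<open>b i\<close> is an eigenvector of the integer
  matrix \<open>c\<close>, so \<open>x\<close> is a root of its characteristic polynomial, which is
  monic with integer coefficients.\<close>

lemma algebraic_int_eigenvalue:
  fixes x :: "'a :: field_char_0" and n :: nat
  assumes stable: "\<And>i. i < n \<Longrightarrow> x * b i = (\<Sum>j<n. of_int (c i j) * b j)"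
    and nz: "k < n" "b k \<noteq> 0"
  shows "algebraic_int x"
proof -
  define A where "A = mat n n (\<lambda>(i, j). c i j)"
  define v where "v = vec n b"
  have A: "A \<in> carrier_mat n n"
    by (simp add: A_def)
  have "map_mat of_int A *\<^sub>v v = x \<cdot>\<^sub>v v"
    by (rule eq_vecI) (auto simp: A_def v_def scalar_prod_def stable atLeast0LessThan)
  moreover have "v \<noteq> 0\<^sub>v n"
    using nz by (auto simp: v_def vec_eq_iff)
  ultimately have "eigenvalue (map_mat of_int A) x"
    using A unfolding eigenvalue_def eigenvector_def by (intro exI[of _ v]) (auto simp: v_def)
  hence "poly (char_poly (map_mat of_int A)) x = 0"
    using A by (subst eigenvalue_root_char_poly[symmetric, where n = n]) auto
  also have "char_poly (map_mat of_int A :: 'a mat) = map_poly of_int (char_poly A)"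
    by (rule of_int_hom.char_poly_hom[OF A])
  finally show ?thesis
    using degree_monic_char_poly[OF A] by (auto simp: algebraic_int_altdef_ipoly)
qed

text \<open>Makes the field a module over the integers, so that \<open>int_span.span\<close> is the
  additive group generated by a set.\<close>

definition int_scale :: "int \<Rightarrow> 'a \<Rightarrow> 'a :: field_char_0" where
  "int_scale c x = of_int c * x"

interpretation int_span: Modules.module "int_scale :: int \<Rightarrow> 'a \<Rightarrow> 'a :: field_char_0"
  by unfold_locales (auto simp: int_scale_def algebra_simps)

text \<open>Enumerating \<open>B\<close> brings the stability condition into the matrix form of
  \<open>algebraic_int_eigenvalue\<close>; \<open>b0\<close> ensures a nonzero eigenvector.\<close>

lemma algebraic_int_stable_span:
  fixes x :: "'a :: field_char_0"
  assumes fin: "finite B" and nz: "b0 \<in> B" "b0 \<noteq> 0"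
    and stable: "\<And>b. b \<in> B \<Longrightarrow> x * b \<in> int_span.span B"
  shows "algebraic_int x"
proof -
  obtain e where e: "bij_betw e {..<card B} B"
    using ex_bij_betw_nat_finite[OF fin] by (auto simp: atLeast0LessThan)
  have "\<exists>u. x * e i = (\<Sum>j<card B. of_int (u j) * e j)" if "i < card B" for i
  proof -
    have "e i \<in> B"
      using e that by (auto simp: bij_betw_def)
    then obtain u where u: "x * e i = (\<Sum>b\<in>B. of_int (u b) * b)"
      using stable[of "e i"] by (auto simp: int_span.span_finite[OF fin] int_scale_def)
    also have "\<dots> = (\<Sum>j<card B. of_int (u (e j)) * e j)"
      by (rule sum.reindex_bij_betw[OF e, symmetric])
    finally show ?thesis
      by (intro exI[of _ "\<lambda>j. u (e j)"])
  qed
  then obtain c where c: "\<And>i. i < card B \<Longrightarrow> x * e i = (\<Sum>j<card B. of_int (c i j) * e j)"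
    by metis
  have "b0 \<in> e ` {..<card B}"
    using e nz(1) by (simp add: bij_betw_def)
  then obtain k where "k < card B" "e k = b0"
    by auto
  thus ?thesis
    using algebraic_int_eigenvalue[OF c, of k] nz(2) by blast
qed

lemma int_span_mult_closed:
  fixes x :: "'a :: field_char_0"
  assumes "\<And>b. b \<in> B \<Longrightarrow> x * b \<in> int_span.span B" and "m \<in> int_span.span B"
  shows "x * m \<in> int_span.span B"
  using assms(2)
proof (induction rule: int_span.span_induct_alt)
  case base
  show ?case by (simp add: int_span.span_zero)
next
  case (step c b m)
  have "x * (int_scale c b + m) = int_scale c (x * b) + x * m"
    by (simp add: int_scale_def algebra_simps)
  thus ?case
    using step assms(1) by (simp only:) (intro int_span.span_add int_span.span_scale; simp)
qed

text \<open>Multiplication by \<open>x\<close> leaves the list of powers only at the top exponent,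
  where the monic equation of \<open>x\<close> rewrites \<open>x ^ degree p\<close> through lower
  powers. The factor \<open>z\<close> will be a fixed power of a second number.\<close>

lemma int_span_powers_stable:
  fixes x :: "'a :: field_char_0"
  assumes p: "lead_coeff p = 1" "poly (map_poly of_int p) x = 0" and i: "i < degree p"
  shows "x ^ Suc i * z \<in> int_span.span ((\<lambda>i. x ^ i * z) ` {..<degree p})"
proof (cases "Suc i < degree p")
  case True
  thus ?thesis by (intro int_span.span_base image_eqI[of _ _ "Suc i"]) auto
next
  case False
  with i have n: "degree p = Suc i" by simp
  have "0 = poly (map_poly of_int p) x"
    by (simp add: p)
  also have "\<dots> = (\<Sum>j\<le>Suc i. of_int (Polynomial.coeff p j) * x ^ j)"
    by (simp add: poly_altdef degree_map_poly coeff_map_poly n)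
  also have "\<dots> = (\<Sum>j<Suc i. of_int (Polynomial.coeff p j) * x ^ j) + x ^ Suc i"
    using p(1) n by (simp add: lessThan_Suc_atMost)
  finally have "x ^ Suc i = (\<Sum>j<Suc i. of_int (- Polynomial.coeff p j) * x ^ j)"
    by (simp add: sum_negf eq_neg_iff_add_eq_0 add.commute del: sum.lessThan_Suc power_Suc)
  hence "x ^ Suc i * z = (\<Sum>j<Suc i. int_scale (- Polynomial.coeff p j) (x ^ j * z))"
    by (simp add: int_scale_def sum_distrib_right mult.assoc del: sum.lessThan_Suc)
  also have "\<dots> \<in> int_span.span ((\<lambda>i. x ^ i * z) ` {..<degree p})"
    unfolding n by (intro int_span.span_sum int_span.span_scale int_span.span_base) auto
  finally show ?thesis .
qed

text \<open>\<open>B\<close> consists of the products of powers below the two degrees and generates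
  the lattice Z[x, y]. Being stable under both numbers, this lattice is stable under their sum and
  product.\<close>

lemma algebraic_int_common_lattice:
  fixes x y :: "'a :: field_char_0"
  assumes "algebraic_int x" "algebraic_int y"
  obtains B where "finite B" "1 \<in> B"
    "\<And>b. b \<in> B \<Longrightarrow> x * b \<in> int_span.span B" "\<And>b. b \<in> B \<Longrightarrow> y * b \<in> int_span.span B"
proof -
  obtain p where p: "poly (map_poly of_int p) x = 0" "lead_coeff p = 1"
    using assms(1) by (auto simp: algebraic_int_altdef_ipoly)
  obtain q where q: "poly (map_poly of_int q) y = 0" "lead_coeff q = 1"
    using assms(2) by (auto simp: algebraic_int_altdef_ipoly)
  \<comment> \<open>A monic polynomial with a root is not constant, so the exponent pair
    \<open>(0, 0)\<close> occurs and \<open>1\<close> lies in \<open>B\<close>.\<close>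
  have pos: "degree r > 0" if "poly (map_poly of_int r) z = 0" "lead_coeff r = 1"
    for r and z :: 'a
    using that by (intro Nat.gr0I) (auto elim!: degree_eq_zeroE)
  define B where "B = (\<lambda>(i, j). x ^ i * y ^ j) ` ({..<degree p} \<times> {..<degree q})"
  show ?thesis
  proof (rule that[of B])
    show "finite B" by (simp add: B_def)
    show "1 \<in> B"
      using pos[OF p] pos[OF q] by (auto simp: B_def intro!: image_eqI[of _ _ "(0, 0)"])
  next
    fix b assume "b \<in> B"
    then obtain i j where ij: "i < degree p" "j < degree q" "b = x ^ i * y ^ j"
      by (auto simp: B_def)
    have "x ^ Suc i * y ^ j \<in> int_span.span ((\<lambda>i. x ^ i * y ^ j) ` {..<degree p})"
      by (rule int_span_powers_stable) (use p ij in auto)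
    moreover have "(\<lambda>i. x ^ i * y ^ j) ` {..<degree p} \<subseteq> B"
      using ij by (auto simp: B_def)
    ultimately show "x * b \<in> int_span.span B"
      using int_span.span_mono[of _ B] by (auto simp: ij mult_ac)
    have "y ^ Suc j * x ^ i \<in> int_span.span ((\<lambda>j. y ^ j * x ^ i) ` {..<degree q})"
      by (rule int_span_powers_stable) (use q ij in auto)
    moreover have "(\<lambda>j. y ^ j * x ^ i) ` {..<degree q} \<subseteq> B"
      using ij by (auto simp: B_def mult_ac)
    ultimately show "y * b \<in> int_span.span B"
      using int_span.span_mono[of _ B] by (auto simp: ij mult_ac)
  qed
qed

lemma algebraic_int_add:
  fixes x y :: "'a :: field_char_0"
  assumes "algebraic_int x" "algebraic_int y"
  shows "algebraic_int (x + y)"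
proof -
  obtain B where B: "finite B" "1 \<in> B"
    "\<And>b. b \<in> B \<Longrightarrow> x * b \<in> int_span.span B" "\<And>b. b \<in> B \<Longrightarrow> y * b \<in> int_span.span B"
    using algebraic_int_common_lattice[OF assms] by blast
  show ?thesis
    by (rule algebraic_int_stable_span[OF B(1,2)])
       (auto simp: ring_distribs intro!: int_span.span_add B)
qed

lemma algebraic_int_mult:
  fixes x y :: "'a :: field_char_0"
  assumes "algebraic_int x" "algebraic_int y"
  shows "algebraic_int (x * y)"
proof -
  obtain B where B: "finite B" "1 \<in> B"
    "\<And>b. b \<in> B \<Longrightarrow> x * b \<in> int_span.span B" "\<And>b. b \<in> B \<Longrightarrow> y * b \<in> int_span.span B"
    using algebraic_int_common_lattice[OF assms] by blast
  show ?thesis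
    by (rule algebraic_int_stable_span[OF B(1,2)])
       (auto simp: mult.assoc intro: int_span_mult_closed B)
qed

section \<open>Integers of quadratic fields\<close>

text \<open>A partial homomorphism is represented by its graph \<open>R\<close>, a subring of the product ring.\<close>

lemma algebraic_int_graph:
  fixes R :: "(real \<times> real) set"
  assumes add: "\<And>x y x' y'. (x, x') \<in> R \<Longrightarrow> (y, y') \<in> R \<Longrightarrow> (x + y, x' + y') \<in> R"
    and mult: "\<And>x y x' y'. (x, x') \<in> R \<Longrightarrow> (y, y') \<in> R \<Longrightarrow> (x * y, x' * y') \<in> R"
    and ints: "\<And>k :: int. (of_int k, of_int k) \<in> R"
    and zero: "\<And>y. (0, y) \<in> R \<Longrightarrow> y = 0"
    and R: "(x, x') \<in> R" and x: "algebraic_int x"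
  shows "algebraic_int x'"
proof -
  have eval: "(poly (map_poly of_int p) x, poly (map_poly of_int p) x') \<in> R" for p :: "int poly"
  proof (induction p)
    case 0
    show ?case using ints[of 0] by simp
  next
    case (pCons a p)
    show ?case
      using add[OF ints[of a] mult[OF R pCons.IH]] pCons.hyps
      by (simp add: map_poly_pCons)
  qed
  obtain p where p: "poly (map_poly of_int p) x = 0" "lead_coeff p = 1"
    using x by (auto simp: algebraic_int_altdef_ipoly)
  have "poly (map_poly of_int p) x' = 0"
    using eval[of p] p(1) zero by simp
  thus ?thesis
    using p(2) by (auto simp: algebraic_int_altdef_ipoly)
qed

text \<open>A rational algebraic integer is an integer, so a rational root would make
  \<open>d\<close> a perfect square greater than 1.\<close>

lemma sqrt_squarefree_irrational:
  fixes d :: nat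
  assumes "squarefree d" "d > 1"
  shows "sqrt (real d) \<notin> \<rat>"
proof
  assume "sqrt (real d) \<in> \<rat>"
  hence "sqrt (real d) \<in> \<int>"
    by (intro rational_algebraic_int_is_int) auto
  then obtain k where k: "sqrt (real d) = of_int k"
    by (auto elim: Ints_cases)
  have "real_of_int (int d) = sqrt (real d) ^ 2"
    by simp
  also have "\<dots> = of_int (k ^ 2)"
    unfolding k by simp
  finally have "int d = k ^ 2"
    by (simp only: of_int_eq_iff)
  hence "d = nat \<bar>k\<bar> ^ 2"
    by (simp flip: of_nat_eq_iff[where 'a = int])
  hence "nat \<bar>k\<bar> ^ 2 dvd d" by simp
  hence "nat \<bar>k\<bar> dvd 1"
    using assms(1) unfolding squarefree_def by blast
  hence "nat \<bar>k\<bar> = 1" by simp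
  thus False
    using \<open>d = nat \<bar>k\<bar> ^ 2\<close> assms(2) by simp
qed

text \<open>Write \<open>d = g * e\<close> with \<open>g = gcd d n\<close>. Coprimality of the
  cofactors forces \<open>e\<close> to divide \<open>g\<close>, so \<open>e ^ 2\<close> divides
  \<open>d\<close> and \<open>e = 1\<close>.\<close>

lemma squarefree_dvd_square:
  fixes d n :: nat
  assumes "squarefree d" "d dvd n ^ 2"
  shows "d dvd n"
proof (cases "n = 0")
  case False
  define g where "g = gcd d n"
  have "g \<noteq> 0" using False by (simp add: g_def)
  obtain e f where ef: "d = g * e" "n = g * f" "coprime e f"
    using gcd_coprime_exists[of d n] \<open>g \<noteq> 0\<close> unfolding g_def by (metis mult.commute)
  have "g * e dvd g * (g * f ^ 2)"
    using assms(2) by (simp add: ef power2_eq_square mult_ac)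
  hence "e dvd g * f ^ 2"
    using \<open>g \<noteq> 0\<close> by simp
  hence "e dvd g"
    using ef(3) by (simp add: coprime_dvd_mult_left_iff)
  hence "e ^ 2 dvd d"
    by (simp add: ef power2_eq_square)
  hence "e dvd 1"
    using assms(1) squarefreeD by blast
  thus ?thesis by (simp add: ef)
qed auto

lemma quad_coords_zero:
  assumes "sqrt d \<notin> \<rat>" "a \<in> \<rat>" "b \<in> \<rat>" "a + b * sqrt d = 0"
  shows "a = 0 \<and> b = 0"
proof -
  have "b = 0"
  proof (rule ccontr)
    assume "b \<noteq> 0"
    hence "sqrt d = - a / b"
      using assms(4) by (simp add: field_simps)
    thus False using assms by simp
  qed
  thus ?thesis using assms(4) by simp
qed

lemma quad_mult:
  fixes d s :: real
  assumes "s * s = d"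
  shows "(a + b * s) * (a' + b' * s) = (a * a' + b * b' * d) + (a * b' + b * a') * s"
  unfolding assms[symmetric] by (simp add: algebra_simps)

text \<open>Conjugation is a ring homomorphism with graph \<open>R\<close>; irrationality of the
  root makes the coordinates of 0 unique, as \<open>algebraic_int_graph\<close> requires.\<close>

lemma quad_conj_algebraic_int:
  fixes d :: nat
  assumes d: "squarefree d" "d > 1" and ab: "a \<in> \<rat>" "b \<in> \<rat>"
    and x: "algebraic_int (a + b * sqrt (real d))"
  shows "algebraic_int (a - b * sqrt (real d))"
proof -
  define R where "R = {(a + b * sqrt (real d), a - b * sqrt (real d)) | a b. a \<in> \<rat> \<and> b \<in> \<rat>}"
  note irr = sqrt_squarefree_irrational[OF d]
  show ?thesis
  proof (rule algebraic_int_graph[of R, OF _ _ _ _ _ x])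
    fix x y x' y' assume "(x, x') \<in> R" "(y, y') \<in> R"
    then obtain a b a' b' where *: "a \<in> \<rat>" "b \<in> \<rat>" "a' \<in> \<rat>" "b' \<in> \<rat>"
      "x = a + b * sqrt d" "x' = a - b * sqrt d" "y = a' + b' * sqrt d" "y' = a' - b' * sqrt d"
      by (auto simp: R_def)
    show "(x + y, x' + y') \<in> R"
      unfolding R_def using * by (intro CollectI exI[of _ "a + a'"] exI[of _ "b + b'"])
        (auto simp: algebra_simps)
    have "x * y = (a * a' + b * b' * d) + (a * b' + b * a') * sqrt d"
      unfolding *(5-8) by (rule quad_mult) simp
    moreover have "x' * y' = (a * a' + b * b' * d) - (a * b' + b * a') * sqrt d"
      unfolding *(5-8) using quad_mult[of "- sqrt d" d a b a' b'] by simp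
    ultimately show "(x * y, x' * y') \<in> R"
      unfolding R_def using *(1-4)
      by (intro CollectI exI[of _ "a * a' + b * b' * d"] exI[of _ "a * b' + b * a'"]) auto
  next
    fix k :: int
    show "(of_int k, of_int k) \<in> R"
      unfolding R_def by (intro CollectI exI[of _ "of_int k"] exI[of _ 0]) auto
  next
    fix y assume "(0, y) \<in> R"
    then obtain a b where "a \<in> \<rat>" "b \<in> \<rat>" "a + b * sqrt d = 0" "y = a - b * sqrt d"
      by (auto simp: R_def)
    thus "y = 0" using quad_coords_zero[OF irr, of a b] by simp
  next
    show "(a + b * sqrt d, a - b * sqrt d) \<in> R"
      using ab by (auto simp: R_def)
  qed
qed

text \<open>Trace and norm are rational algebraic integers, hence integers. The parity condition on
  \<open>m\<close> and \<open>n\<close> is encoded in the divisibility of the norm form by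
  4.\<close>

lemma quad_integer:
  fixes d :: nat
  assumes d: "squarefree d" "d > 1" and x: "x \<in> ring_of_integers (quad_field (real d))"
  obtains m n N :: int where "x = (of_int m + of_int n * sqrt (real d)) / 2"
    "m ^ 2 - int d * n ^ 2 = 4 * N"
proof -
  obtain a b where ab: "a \<in> \<rat>" "b \<in> \<rat>" "x = a + b * sqrt (real d)"
    and ax: "algebraic_int x"
    using x by (auto simp: ring_of_integers_def quad_field_def)
  have ac: "algebraic_int (a - b * sqrt (real d))"
    using quad_conj_algebraic_int[OF d ab(1,2)] ax ab(3) by simp
  have "algebraic_int (2 * a)"
    using algebraic_int_add[OF ax ac] ab(3) by simp
  hence "2 * a \<in> \<int>"
    using ab by (intro rational_algebraic_int_is_int) auto
  then obtain m where m: "2 * a = of_int m"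
    by (auto elim: Ints_cases)
  have "algebraic_int (a ^ 2 - b ^ 2 * real d)"
    using algebraic_int_mult[OF ax ac] ab(3) by (simp add: algebra_simps power2_eq_square)
  hence "a ^ 2 - b ^ 2 * real d \<in> \<int>"
    using ab by (intro rational_algebraic_int_is_int) auto
  then obtain N where N: "a ^ 2 - b ^ 2 * real d = of_int N"
    by (auto elim: Ints_cases)
  have sq: "real d * (2 * b) ^ 2 = of_int (m ^ 2 - 4 * N)"
  proof -
    have "real d * (2 * b) ^ 2 = (2 * a) ^ 2 - 4 * (a ^ 2 - b ^ 2 * real d)"
      by (simp add: power2_eq_square)
    also have "\<dots> = of_int (m ^ 2 - 4 * N)"
      unfolding m N by simp
    finally show ?thesis .
  qed
  \<comment> \<open>The square of \<open>d * (2 * b)\<close> is visibly an integer; the extra factor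
    \<open>d\<close> is divided out afterwards by squarefreeness.\<close>
  have "algebraic_int ((real d * (2 * b)))"
  proof -
    have "(real d * (2 * b)) ^ 2 = of_int (int d * (m ^ 2 - 4 * N))"
      using sq by (simp add: power2_eq_square mult_ac)
    hence "algebraic_int ((real d * (2 * b)) ^ 2)"
      by (simp only: algebraic_int_of_int)
    hence "algebraic_int (sqrt ((real d * (2 * b)) ^ 2))" by blast
    thus ?thesis by (simp only: real_sqrt_abs algebraic_int_abs_real)
  qed
  hence "real d * (2 * b) \<in> \<int>"
    using ab by (intro rational_algebraic_int_is_int) auto
  then obtain n' where n': "real d * (2 * b) = of_int n'"
    by (auto elim: Ints_cases)
  have "real_of_int (n' ^ 2) = of_int (int d * (m ^ 2 - 4 * N))"
    using sq by (simp add: n'[symmetric] power2_eq_square mult_ac)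
  hence "n' ^ 2 = int d * (m ^ 2 - 4 * N)"
    by (simp only: of_int_eq_iff)
  hence "int d dvd n' ^ 2" by simp
  hence "d dvd nat \<bar>n'\<bar> ^ 2"
    by (simp add: nat_abs_dvd_iff flip: int_dvd_int_iff)
  hence "d dvd nat \<bar>n'\<bar>"
    by (rule squarefree_dvd_square[OF d(1)])
  hence "int d dvd n'"
    by (simp add: int_dvd_int_iff)
  then obtain n where n: "n' = int d * n" by blast
  have b: "2 * b = of_int n"
    using n' d(2) by (simp add: n)
  show ?thesis
  proof (rule that[of m n N])
    show "x = (of_int m + of_int n * sqrt (real d)) / 2"
      by (simp add: ab(3) m[symmetric] b[symmetric] field_simps)
    have "real_of_int (int d * n ^ 2) = of_int (m ^ 2 - 4 * N)"
      using sq b by simp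
    hence "int d * n ^ 2 = m ^ 2 - 4 * N"
      by (simp only: of_int_eq_iff)
    thus "m ^ 2 - int d * n ^ 2 = 4 * N" by simp
  qed
qed

section \<open>Units of quadratic fields and the Pell equation\<close>

text \<open>These closure conditions make the units a group containing \<open>-1\<close>. Both the
  quadratic fields and the biquadratic field are instances.\<close>

locale real_subring =
  fixes K :: "real set"
  assumes one_closed: "1 \<in> K"
    and minus_closed: "x \<in> K \<Longrightarrow> - x \<in> K"
    and mult_closed: "x \<in> K \<Longrightarrow> y \<in> K \<Longrightarrow> x * y \<in> K"
begin

lemma unit_mult: "u \<in> units_of_field K \<Longrightarrow> v \<in> units_of_field K \<Longrightarrow> u * v \<in> units_of_field K"
  by (auto simp: units_of_field_def ring_of_integers_def algebraic_int_mult mult_closed)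

lemma unit_inverse: "u \<in> units_of_field K \<Longrightarrow> inverse u \<in> units_of_field K"
  by (auto simp: units_of_field_def)

lemma unit_one: "1 \<in> units_of_field K"
  by (auto simp: units_of_field_def ring_of_integers_def one_closed)

lemma unit_minus: "u \<in> units_of_field K \<Longrightarrow> - u \<in> units_of_field K"
  by (auto simp: units_of_field_def ring_of_integers_def minus_closed)

lemma unit_power: "u \<in> units_of_field K \<Longrightarrow> u ^ n \<in> units_of_field K"
  by (induction n) (auto simp: unit_one unit_mult)

lemma unit_powi: "u \<in> units_of_field K \<Longrightarrow> u powi k \<in> units_of_field K"
  by (auto simp: power_int_def unit_power unit_inverse)

end

lemma quad_subring: "real_subring (quad_field (real d))"
proof
  show "1 \<in> quad_field (real d)"
    unfolding quad_field_def by (intro CollectI exI[of _ 1] exI[of _ 0]) auto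
next
  fix x assume "x \<in> quad_field (real d)"
  then obtain a b where "a \<in> \<rat>" "b \<in> \<rat>" "x = a + b * sqrt d"
    by (auto simp: quad_field_def)
  thus "- x \<in> quad_field (real d)"
    unfolding quad_field_def by (intro CollectI exI[of _ "- a"] exI[of _ "- b"]) auto
next
  fix x y assume "x \<in> quad_field (real d)" "y \<in> quad_field (real d)"
  then obtain a b a' b' where *: "a \<in> \<rat>" "b \<in> \<rat>" "x = a + b * sqrt d"
    "a' \<in> \<rat>" "b' \<in> \<rat>" "y = a' + b' * sqrt d"
    by (auto simp: quad_field_def)
  have "x * y = (a * a' + b * b' * d) + (a * b' + b * a') * sqrt d"
    unfolding *(3,6) by (rule quad_mult) simp
  thus "x * y \<in> quad_field (real d)"
    unfolding quad_field_def using *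
    by (intro CollectI exI[of _ "a * a' + b * b' * d"] exI[of _ "a * b' + b * a'"]) auto
qed

text \<open>This is the fact that -1 is not a square modulo \<open>p\<close>: otherwise raising
  \<open>x ^ 2 = - (y ^ 2)\<close> to an odd power and applying Fermat gives 1 = -1 modulo
  \<open>p\<close>.\<close>

lemma prime_3mod4_dvd_sum_squares:
  fixes x y :: int
  assumes "prime p" "p mod 4 = 3" "int p dvd x ^ 2 + y ^ 2"
  shows "int p dvd y"
proof (rule ccontr)
  assume y: "\<not> int p dvd y"
  have p: "prime (int p)" using assms(1) by simp
  have x: "\<not> int p dvd x"
  proof
    assume "int p dvd x"
    hence "int p dvd x ^ 2" by (simp add: power2_eq_square)
    hence "int p dvd y ^ 2" using assms(3) by (simp add: dvd_add_right_iff)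
    thus False using y p prime_dvd_power by blast
  qed
  obtain k where k: "p = 4 * k + 3"
    using assms(2) by (metis mult_div_mod_eq)
  have fermat: "[z ^ (p - 1) = 1] (mod int p)" if "\<not> int p dvd z" for z :: int
  proof -
    have "coprime z (int p)"
      using prime_imp_coprime[OF p that] by (simp add: coprime_commute)
    moreover have "residues (int p)"
      using prime_gt_1_nat[OF assms(1)] by unfold_locales auto
    ultimately show ?thesis
      using residues.euler_theorem[of "int p" z] by (simp add: totient_prime[OF assms(1)])
  qed
  have "[x ^ 2 = - (y ^ 2)] (mod int p)"
    using assms(3) by (simp add: cong_iff_dvd_diff)
  \<comment> \<open>The exponent is half of \<open>p - 1\<close> and odd because
    \<open>p mod 4 = 3\<close>, so the sign survives.\<close>
  hence "[(x ^ 2) ^ (2 * k + 1) = (- (y ^ 2)) ^ (2 * k + 1)] (mod int p)"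
    by (rule cong_pow)
  moreover have "2 * (2 * k + 1) = p - 1" "odd (2 * k + 1)" by (simp_all add: k)
  ultimately have "[x ^ (p - 1) = - (y ^ (p - 1))] (mod int p)"
    by (metis power_minus_odd power_mult)
  hence "[1 = - 1] (mod int p)"
    using fermat[OF x] fermat[OF y] by (metis cong_minus_minus_iff cong_sym cong_trans)
  hence "int p dvd 2"
    by (simp add: cong_iff_dvd_diff)
  hence "p \<le> 2"
    by (auto dest: zdvd_imp_le)
  thus False by (simp add: k)
qed

text \<open>A unit has norm 1 or -1. Norm -1 would make \<open>m ^ 2 + 2 ^ 2\<close> divisible by
  \<open>p\<close>, hence \<open>p\<close> a divisor of 2.\<close>

lemma quad_unit_pell:
  fixes d :: nat
  assumes d: "squarefree d" "d > 1" and p: "prime p" "p mod 4 = 3" "p dvd d"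
    and u: "u \<in> units_of_field (quad_field (real d))"
  obtains m n :: int where "u = (of_int m + of_int n * sqrt (real d)) / 2" "m ^ 2 - int d * n ^ 2 = 4"
proof -
  obtain m n N where 1: "u = (of_int m + of_int n * sqrt (real d)) / 2" "m ^ 2 - int d * n ^ 2 = 4 * N"
    using u by (auto simp: units_of_field_def elim: quad_integer[OF d])
  obtain m' n' N' where 2: "inverse u = (of_int m' + of_int n' * sqrt (real d)) / 2"
      "m' ^ 2 - int d * n' ^ 2 = 4 * N'"
    using u by (auto simp: units_of_field_def elim: quad_integer[OF d])
  have "(of_int m + of_int n * sqrt d) * (of_int m' + of_int n' * sqrt d) = (2 * u) * (2 * inverse u)"
    unfolding 2(1) unfolding 1(1) by (simp add: field_simps)
  also have "\<dots> = 4"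
    using u by (simp add: units_of_field_def)
  finally have "(of_int m + of_int n * sqrt d) * (of_int m' + of_int n' * sqrt d) = 4" .
  hence "of_int (m * m' + n * n' * d) - 4 + of_int (m * n' + n * m') * sqrt d = 0"
    by (subst (asm) quad_mult[of _ d]) auto
  from quad_coords_zero[OF sqrt_squarefree_irrational[OF d] _ _ this]
  have "real_of_int (m * m' + n * n' * d) = of_int 4" "real_of_int (m * n' + n * m') = of_int 0"
    by auto
  hence *: "m * m' + n * n' * d = 4" "m * n' + n * m' = 0"
    by (simp_all only: of_int_eq_iff)
  \<comment> \<open>Multiplicativity of the norm, applied to the product of \<open>u\<close> and its
    inverse.\<close>
  have "(4 * N) * (4 * N') = (m * m' + n * n' * d) ^ 2 - d * (m * n' + n * m') ^ 2"
    unfolding 1(2)[symmetric] 2(2)[symmetric] by (simp add: power2_eq_square algebra_simps)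
  hence "N * N' = 1"
    unfolding * by simp
  hence "N = 1 \<or> N = - 1"
    by (auto simp: zmult_eq_1_iff)
  moreover have "N \<noteq> - 1"
  proof
    assume "N = - 1"
    hence "m ^ 2 + 2 ^ 2 = int d * n ^ 2" using 1(2) by simp
    moreover have "int p dvd int d" using p(3) by simp
    ultimately have "int p dvd m ^ 2 + 2 ^ 2" by simp
    hence "int p dvd 2" by (rule prime_3mod4_dvd_sum_squares[OF p(1,2)])
    hence "p \<le> 2" by (auto dest: zdvd_imp_le)
    thus False using p(1,2) prime_gt_1_nat[of p] by (cases "p = 2") auto
  qed
  ultimately show ?thesis using 1 that by auto
qed

text \<open>The number is a root of X^2 - m X + 1, and its conjugate is its inverse.\<close>

lemma pell_quad_unit:
  fixes d :: nat and m n :: int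
  assumes "m ^ 2 - int d * n ^ 2 = 4"
  shows "(of_int m + of_int n * sqrt (real d)) / 2 \<in> units_of_field (quad_field (real d))"
proof -
  let ?u = "\<lambda>n. (of_int m + of_int n * sqrt (real d)) / 2"
  have mem: "?u n \<in> ring_of_integers (quad_field (real d))" if "m ^ 2 - int d * n ^ 2 = 4" for n
  proof -
    have "?u n = of_int m / 2 + of_int n / 2 * sqrt d"
      by (simp add: field_simps)
    hence "?u n \<in> quad_field (real d)"
      unfolding quad_field_def by (intro CollectI exI[of _ "of_int m / 2"] exI[of _ "of_int n / 2"]) auto
    moreover have "algebraic_int (?u n)"
    proof (rule algebraic_int.intros[of "[:1, - of_int m, 1:]"])
      have "real_of_int (m ^ 2 - int d * n ^ 2) = 4"
        using that by simp
      hence "(of_int n * sqrt d) * (of_int n * sqrt d) = real_of_int m ^ 2 - 4"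
        by (simp add: power2_eq_square mult_ac)
      thus "poly [:1, - of_int m, 1:] (?u n) = 0"
        by (simp add: field_simps power2_eq_square)
    qed (auto simp: coeff_pCons split: nat.splits)
    ultimately show ?thesis by (simp add: ring_of_integers_def)
  qed
  have "real_of_int (m ^ 2 - int d * n ^ 2) = 4"
    using assms by simp
  hence prod: "?u n * ?u (- n) = 1"
    by (simp add: field_simps power2_eq_square)
  hence "inverse (?u n) = ?u (- n)"
    by (rule inverse_unique)
  moreover have "?u n \<noteq> 0"
    using prod by (metis mult_zero_left zero_neq_one)
  ultimately show ?thesis
    using mem[of n] mem[of "- n"] assms
    unfolding units_of_field_def mem_Collect_eq by (metis power2_minus)
qed

text \<open>Since \<open>(m - 2) * (m + 2) = d * n ^ 2\<close>, the two roots multiply to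
  \<open>n * sqrt d\<close>, while their squares add up to \<open>2 * m\<close>. Thus the
  factorizations of \<open>m - 2\<close> and \<open>m + 2\<close> describe the square root of the
  unit.\<close>

lemma pell_sqrt:
  fixes d m n :: nat
  assumes "m ^ 2 = d * n ^ 2 + 4"
  shows "(real m + real n * sqrt d) / 2 = ((sqrt (real (m - 2)) + sqrt (real (m + 2))) / 2) ^ 2"
proof -
  have "m \<ge> 2"
  proof (rule ccontr)
    assume "\<not> m \<ge> 2"
    hence "m = 0 \<or> m = 1" by auto
    thus False using assms by auto
  qed
  hence m: "real (m - 2) = real m - 2" by simp
  have "real (m ^ 2) = real (d * n ^ 2 + 4)"
    using assms by simp
  hence "(real m - 2) * (real m + 2) = (real n * sqrt d) ^ 2"
    by (simp add: power_mult_distrib algebra_simps power2_eq_square)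
  hence "sqrt (real m - 2) * sqrt (real m + 2) = real n * sqrt d"
    by (simp flip: real_sqrt_mult)
  thus ?thesis
    using \<open>m \<ge> 2\<close> unfolding m by (simp add: power2_sum power_divide field_simps)
qed

text \<open>The conjugate is the inverse, so \<open>\<epsilon> + inverse \<epsilon>\<close> equals
  \<open>m\<close> and \<open>\<epsilon> - inverse \<epsilon>\<close> equals
  \<open>n * sqrt d\<close>; both are positive because \<open>\<epsilon> > 1\<close>.\<close>

lemma fundamental_unit_pell:
  fixes d :: nat
  assumes d: "squarefree d" "d > 1" and p: "prime p" "p mod 4 = 3" "p dvd d"
    and \<epsilon>: "is_fundamental_unit (real d) \<epsilon>"
  obtains m n :: nat where "\<epsilon> = (real m + real n * sqrt (real d)) / 2" "m ^ 2 = d * n ^ 2 + 4" "n > 0"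
proof -
  have "\<epsilon> \<in> units_of_field (quad_field (real d))" and gt: "\<epsilon> > 1"
    using \<epsilon> by (auto simp: is_fundamental_unit_def)
  then obtain m n :: int where mn: "\<epsilon> = (of_int m + of_int n * sqrt (real d)) / 2" "m ^ 2 - int d * n ^ 2 = 4"
    using quad_unit_pell[OF d p] by blast
  have "real_of_int (m ^ 2 - int d * n ^ 2) = 4"
    using mn by simp
  hence "\<epsilon> * ((of_int m - of_int n * sqrt (real d)) / 2) = 1"
    by (simp add: mn(1) field_simps power2_eq_square)
  hence inv: "inverse \<epsilon> = (of_int m - of_int n * sqrt (real d)) / 2"
    by (rule inverse_unique)
  have "inverse \<epsilon> > 0" "inverse \<epsilon> < 1"
    using gt by (auto simp: inverse_less_1_iff)
  hence "\<epsilon> + inverse \<epsilon> > 0" "\<epsilon> - inverse \<epsilon> > 0"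
    using gt by linarith+
  hence "real_of_int m > 0" "of_int n * sqrt (real d) > 0"
    unfolding inv unfolding mn(1) by (simp_all add: field_simps)
  hence "m > 0" "n > 0"
    using d(2) by (auto simp: zero_less_mult_iff)
  show ?thesis
  proof (rule that[of "nat m" "nat n"])
    show "\<epsilon> = (real (nat m) + real (nat n) * sqrt (real d)) / 2"
      using \<open>m > 0\<close> \<open>n > 0\<close> mn by simp
    have "int (nat m ^ 2) = int (d * nat n ^ 2 + 4)"
      using \<open>m > 0\<close> \<open>n > 0\<close> mn by simp
    thus "nat m ^ 2 = d * nat n ^ 2 + 4"
      by (simp only: of_nat_eq_iff)
    show "nat n > 0" using \<open>n > 0\<close> by simp
  qed
qed

text \<open>The square root would be a unit of the same field strictly between 1 and
  \<open>\<epsilon>\<close>.\<close>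

lemma fundamental_unit_not_square:
  fixes d r s :: nat
  assumes \<epsilon>: "is_fundamental_unit (real d) \<epsilon>" and "r ^ 2 = d * s ^ 2 + 4"
    and sq: "\<epsilon> = ((real r + real s * sqrt d) / 2) ^ 2"
  shows False
proof -
  define \<eta> where "\<eta> = (real r + real s * sqrt d) / 2"
  have "int r ^ 2 - int d * int s ^ 2 = 4"
    using arg_cong[OF assms(2), of int] by simp
  hence "\<eta> \<in> units_of_field (quad_field (real d))"
    using pell_quad_unit[of "int r" d "int s"] by (simp add: \<eta>_def)
  moreover have "\<eta> \<ge> 0" "\<eta> ^ 2 > 1"
    using \<epsilon> sq by (auto simp: \<eta>_def is_fundamental_unit_def)
  hence "\<eta> > 1"
    by (smt (verit) one_power2 power_mono)
  moreover from this have "\<eta> < \<epsilon>"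
    by (simp add: sq[folded \<eta>_def] power2_eq_square)
  ultimately show False
    using \<epsilon> by (force simp: is_fundamental_unit_def)
qed

section \<open>Square roots of fundamental units\<close>

text \<open>Once \<open>p\<close> is cancelled from the factor it divides, two coprime numbers
  multiply to a square, so each is a square.\<close>

lemma coprime_prod_prime_square:
  fixes u v p b :: nat
  assumes "prime p" "coprime u v" "u * v = p * b ^ 2" "b > 0"
  shows "\<exists>r s. (u = r ^ 2 \<and> v = p * s ^ 2) \<or> (u = p * r ^ 2 \<and> v = s ^ 2)"
proof -
  have *: "\<exists>r s. x = p * r ^ 2 \<and> y = s ^ 2" if xy: "p dvd x" "coprime x y" "x * y = p * b ^ 2" for x y
  proof -
    obtain x' where x': "x = p * x'" using xy(1) by blast
    have "x' * y = b ^ 2" using xy(3) assms(1) by (simp add: x' prime_gt_0_nat)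
    moreover have "coprime x' y" using xy(2) by (simp add: x')
    moreover have "x' > 0" "y > 0" using \<open>x' * y = b ^ 2\<close> \<open>b > 0\<close> by (auto intro: Nat.gr0I)
    ultimately have "is_nth_power 2 x'" "is_nth_power 2 y"
      using is_nth_power_mult_coprime_natD[of x' y 2] by auto
    thus ?thesis by (auto simp: x' is_nth_power_def)
  qed
  have "p dvd u * v" using assms(3) by simp
  hence "p dvd u \<or> p dvd v" using assms(1) by (simp add: prime_dvd_mult_iff)
  thus ?thesis
  proof
    assume "p dvd u"
    from *[OF this assms(2,3)] show ?thesis by blast
  next
    assume "p dvd v"
    from *[OF this _] assms(2,3) show ?thesis
      by (metis coprime_commute mult.commute)
  qed
qed

lemma coprime_prod_two_primes_square:
  fixes u v p q b :: nat
  assumes "prime p" "prime q" "coprime u v" "u * v = p * q * b ^ 2" "b > 0"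
  shows "\<exists>r s. (u = r ^ 2 \<and> v = p * q * s ^ 2) \<or> (u = p * q * r ^ 2 \<and> v = s ^ 2) \<or>
               (u = p * r ^ 2 \<and> v = q * s ^ 2) \<or> (u = q * r ^ 2 \<and> v = p * s ^ 2)"
proof -
  have *: "\<exists>r s. (x' = r ^ 2 \<and> y = q * s ^ 2) \<or> (x' = q * r ^ 2 \<and> y = s ^ 2)"
    if "coprime (p * x') y" "p * x' * y = p * q * b ^ 2" for x' y
  proof -
    have "x' * y = q * b ^ 2" using that(2) assms(1) by (simp add: prime_gt_0_nat mult.assoc)
    moreover have "coprime x' y" using that(1) by simp
    ultimately show ?thesis
      using coprime_prod_prime_square[of q x' y b] assms(2,5) by blast
  qed
  have "p dvd u * v" using assms(4) by simp
  hence "p dvd u \<or> p dvd v" using assms(1) by (simp add: prime_dvd_mult_iff)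
  thus ?thesis
  proof
    assume "p dvd u"
    then obtain x' where x': "u = p * x'" by blast
    from *[of x' v] assms(3,4) obtain r s where
      "(x' = r ^ 2 \<and> v = q * s ^ 2) \<or> (x' = q * r ^ 2 \<and> v = s ^ 2)"
      unfolding x' by blast
    thus ?thesis unfolding x' by (metis mult.assoc)
  next
    assume "p dvd v"
    then obtain x' where x': "v = p * x'" by blast
    have "coprime (p * x') u" "p * x' * u = p * q * b ^ 2"
      using assms(3,4) unfolding x' by (simp_all add: coprime_commute mult_ac)
    from *[OF this] obtain r s where
      "(x' = r ^ 2 \<and> u = q * s ^ 2) \<or> (x' = q * r ^ 2 \<and> u = s ^ 2)" by blast
    thus ?thesis unfolding x' by (metis mult.assoc)
  qed
qed

lemma coprime_nat_add_2:
  fixes u :: nat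
  assumes "odd u"
  shows "coprime u (u + 2)" "coprime u (u + 4)"
proof -
  have "coprime u 2"
    using assms by simp
  moreover from this have "coprime u (2 * 2)"
    by (simp only: coprime_mult_right_iff)
  hence "coprime u 4" by simp
  ultimately show "coprime u (u + 2)" "coprime u (u + 4)"
    unfolding coprime_iff_gcd_eq_1 gcd_add2 by simp_all
qed

lemma square_mod_8_odd: "odd (n :: nat) \<Longrightarrow> n ^ 2 mod 8 = 1"
proof -
  assume "odd n"
  then obtain k where "n = 2 * k + 1" by (elim oddE)
  hence "n ^ 2 = 4 * (k * (k + 1)) + 1" by (simp add: power2_eq_square algebra_simps)
  moreover have "even (k * (k + 1))" by simp
  then obtain j where "k * (k + 1) = 2 * j" by (elim evenE)
  ultimately have "n ^ 2 = 8 * j + 1" by simp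
  thus ?thesis by simp
qed

text \<open>Excludes the factorizations in which a square and a larger multiple of \<open>p\<close>
  differ by 1 or by 4.\<close>

lemma not_prime_3mod4_dvd_square_plus:
  fixes p r :: nat
  assumes "prime p" "p mod 4 = 3"
  shows "\<not> p dvd r ^ 2 + 1" "\<not> p dvd r ^ 2 + 4"
proof -
  have p: "p > 2"
    using assms prime_gt_1_nat[of p] by (cases "p = 2") auto
  have *: "p dvd k" if "p dvd r ^ 2 + k ^ 2" for k
  proof -
    have "int p dvd int (r ^ 2 + k ^ 2)" using that by (simp only: int_dvd_int_iff)
    thus ?thesis
      using prime_3mod4_dvd_sum_squares[OF assms, of "int r" "int k"] by simp
  qed
  show "\<not> p dvd r ^ 2 + 1" using *[of 1] p by auto
  show "\<not> p dvd r ^ 2 + 4" using *[of 2] p by (auto dest!: dvd_imp_le[of p 2])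
qed

text \<open>Halving the Pell solution gives \<open>a ^ 2 = q * b ^ 2 + 1\<close>. When
  \<open>a\<close> is even, \<open>a - 1\<close> and \<open>a + 1\<close> are coprime, so they are a
  square and \<open>q\<close> times a square; their order fixes the sign and is decided modulo
  8.\<close>

lemma fundamental_unit_prime:
  fixes q :: nat
  assumes q: "prime q" "q mod 4 = 3" and \<epsilon>: "is_fundamental_unit (real q) \<epsilon>"
  obtains r s :: nat where "r > 0" "s > 0" "\<epsilon> = (real r + real s * sqrt (real q)) ^ 2 / 2"
    "int r ^ 2 - int q * int s ^ 2 = (if q mod 8 = 7 then 2 else - 2)"
proof -
  obtain m n where mn: "\<epsilon> = (real m + real n * sqrt (real q)) / 2" "m ^ 2 = q * n ^ 2 + 4" "n > 0"
    using fundamental_unit_pell[OF squarefree_prime[OF q(1)] prime_gt_1_nat[OF q(1)] q dvd_refl \<epsilon>] by blast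
  have sq4: "x ^ 2 mod 4 = (if even x then 0 else 1)" for x :: nat
  proof (cases "even x")
    case False
    have "x ^ 2 mod 8 mod 4 = 1" by (simp add: square_mod_8_odd[OF False])
    thus ?thesis using False by (simp add: mod_mod_cancel)
  qed (auto elim!: evenE simp: power2_eq_square)
  \<comment> \<open>Modulo 4 the equation reads \<open>m ^ 2 = 3 * n ^ 2\<close>, which is
    impossible unless both numbers are even.\<close>
  have "m ^ 2 mod 4 = (q mod 4 * (n ^ 2 mod 4)) mod 4"
    by (simp add: mn(2) mod_simps)
  hence even: "even m" "even n"
    by (auto simp: sq4 q(2) split: if_splits)
  then obtain a b where ab: "m = 2 * a" "n = 2 * b" by (auto elim!: evenE)
  have pell: "a ^ 2 = q * b ^ 2 + 1" and "b > 0"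
    using mn(2,3) by (simp_all add: ab power_mult_distrib)
  have \<epsilon>_sqrt: "\<epsilon> = ((sqrt (real (m - 2)) + sqrt (real (m + 2))) / 2) ^ 2"
    using pell_sqrt[OF mn(2)] mn(1) by simp
  show ?thesis
  \<comment> \<open>An odd \<open>a\<close> is contradictory: \<open>k\<close> and
    \<open>k + 1\<close> would be a square and \<open>q\<close> times a square. In one order
    \<open>q\<close> divides \<open>r ^ 2 + 1\<close>, in the other \<open>\<epsilon>\<close> is the
    square of a unit.\<close>
  proof (cases "odd a")
    case True
    then obtain k where k: "a = 2 * k + 1" by (elim oddE)
    have "q * b ^ 2 = 4 * (k * (k + 1))"
      using pell by (simp add: k power2_eq_square algebra_simps)
    moreover have "odd q" using q(2) by presburger
    ultimately have "even (b ^ 2)" 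
      by (metis dvd_mult2 even_mult_iff even_numeral dvd_triv_left)
    then obtain c where c: "b = 2 * c" by (auto elim!: evenE)
    have "k * (k + 1) = q * c ^ 2" "c > 0"
      using \<open>q * b ^ 2 = _\<close> \<open>b > 0\<close> by (simp_all add: c power_mult_distrib)
    then obtain r s where rs: "(k = r ^ 2 \<and> k + 1 = q * s ^ 2) \<or> (k = q * r ^ 2 \<and> k + 1 = s ^ 2)"
      using coprime_prod_prime_square[of q k "k + 1" c] q(1) by auto
    thus ?thesis
    proof
      assume "k = r ^ 2 \<and> k + 1 = q * s ^ 2"
      hence "q dvd r ^ 2 + 1" by (metis dvd_triv_left)
      thus ?thesis using not_prime_3mod4_dvd_square_plus[OF q] by blast
    next
      assume *: "k = q * r ^ 2 \<and> k + 1 = s ^ 2"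
      have "m - 2 = (2 * r) ^ 2 * q" "m + 2 = (2 * s) ^ 2"
        using * by (auto simp: ab k power_mult_distrib)
      hence "\<epsilon> = ((real (2 * s) + real (2 * r) * sqrt q) / 2) ^ 2"
        by (simp add: \<epsilon>_sqrt real_sqrt_mult add.commute)
      moreover have "(2 * s) ^ 2 = q * (2 * r) ^ 2 + 4"
        using * by (simp add: power_mult_distrib)
      ultimately have False
        using fundamental_unit_not_square[OF \<epsilon>] by blast
      thus ?thesis ..
    qed
  next
    case False
    have "a > 0" using pell by (intro Nat.gr0I) auto
    define u where "u = a - 1"
    have a: "a = u + 1" "odd u" using \<open>a > 0\<close> False by (auto simp: u_def)
    have "u * (u + 2) = q * b ^ 2"
      using pell by (simp add: a(1) power2_eq_square algebra_simps)
    then obtain r s where rs: "(u = r ^ 2 \<and> u + 2 = q * s ^ 2) \<or> (u = q * r ^ 2 \<and> u + 2 = s ^ 2)"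
      using coprime_prod_prime_square[of q u "u + 2" b] q(1) coprime_nat_add_2[OF a(2)] \<open>b > 0\<close> by blast
    have m2: "m - 2 = 2 * u" "m + 2 = 2 * (u + 2)" by (simp_all add: ab a)
    \<comment> \<open>The common factor 2 of \<open>m - 2\<close> and \<open>m + 2\<close> is taken
      out of the roots; this is why \<open>\<epsilon>\<close> becomes half a square and not a
      square.\<close>
    have half: "((sqrt (real (2 * x)) + sqrt (real (2 * y))) / 2) ^ 2 =
                (sqrt (real x) + sqrt (real y)) ^ 2 / 2" for x y :: nat
    proof -
      have "sqrt (real (2 * x)) + sqrt (real (2 * y)) = sqrt 2 * (sqrt (real x) + sqrt (real y))"
        by (simp add: real_sqrt_mult algebra_simps)
      thus ?thesis by (simp add: power_mult_distrib power_divide)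
    qed
    have "odd (q * s ^ 2) \<or> odd (s ^ 2)" "odd (r ^ 2) \<or> odd (q * r ^ 2)"
      using rs a(2) by (metis dvd_add_times_triv_right_iff even_add even_numeral)+
    hence "odd s" "odd r" by auto
    hence mod8: "r ^ 2 mod 8 = 1" "s ^ 2 mod 8 = 1" by (auto simp: square_mod_8_odd)
    from rs show ?thesis
    proof
      assume *: "u = r ^ 2 \<and> u + 2 = q * s ^ 2"
      hence eq: "q * s ^ 2 = r ^ 2 + 2" by simp
      \<comment> \<open>Odd squares are 1 modulo 8, so this order of the factors forces
        \<open>q mod 8 = 3\<close>; the other order forces 7.\<close>
      have "(q mod 8 * (s ^ 2 mod 8)) mod 8 = (r ^ 2 mod 8 + 2) mod 8"
        by (metis eq mod_mult_eq mod_add_left_eq)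
      hence "q mod 8 = 3" by (simp add: mod8)
      have u1: "real u = real r ^ 2" "real (u + 2) = real q * real s ^ 2"
        using * by (metis of_nat_power, metis of_nat_power of_nat_mult)
      have "\<epsilon> = (real r + real s * sqrt (real q)) ^ 2 / 2"
        unfolding \<epsilon>_sqrt m2 half u1 by (simp add: real_sqrt_mult mult.commute add.commute)
      moreover have "int (q * s ^ 2) = int (r ^ 2 + 2)" using eq by (simp only:)
      hence "int r ^ 2 - int q * int s ^ 2 = (if q mod 8 = 7 then 2 else - 2)"
        using \<open>q mod 8 = 3\<close> by simp
      ultimately show ?thesis
        using that[of r s] \<open>odd r\<close> \<open>odd s\<close> by (auto intro: odd_pos)
    next
      assume *: "u = q * r ^ 2 \<and> u + 2 = s ^ 2"
      hence eq: "s ^ 2 = q * r ^ 2 + 2" by simp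
      have "(s ^ 2 mod 8) = (q mod 8 * (r ^ 2 mod 8) + 2) mod 8"
        by (metis eq mod_mult_eq mod_add_left_eq)
      hence "1 = (q mod 8 + 2) mod 8" by (simp only: mod8 mult_1_right)
      hence "q mod 8 = 7" by presburger
      have u1: "real u = real q * real r ^ 2" "real (u + 2) = real s ^ 2"
        using * by (metis of_nat_power of_nat_mult, metis of_nat_power)
      have "\<epsilon> = (real s + real r * sqrt (real q)) ^ 2 / 2"
        unfolding \<epsilon>_sqrt m2 half u1 by (simp add: real_sqrt_mult mult.commute add.commute)
      moreover have "int (s ^ 2) = int (q * r ^ 2 + 2)" using eq by (simp only:)
      hence "int s ^ 2 - int q * int r ^ 2 = (if q mod 8 = 7 then 2 else - 2)"
        using \<open>q mod 8 = 7\<close> by simp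
      ultimately show ?thesis
        using that[of s r] \<open>odd r\<close> \<open>odd s\<close> by (auto intro: odd_pos)
    qed
  qed
qed

text \<open>Up to powers of 2, \<open>m - 2\<close> and \<open>m + 2\<close> are coprime with
  product \<open>p * q\<close> times a square. Splits with both primes on one side fail by sums of
  two squares or by minimality of \<open>\<epsilon>\<close>; the two others give the two signs of
  the norm equation.\<close>

lemma fundamental_unit_two_primes:
  fixes p q :: nat
  assumes p: "prime p" "p mod 4 = 3" and q: "prime q" "q mod 4 = 3" and "p \<noteq> q"
    and \<epsilon>: "is_fundamental_unit (real (p * q)) \<epsilon>"
  obtains r s :: nat where "\<epsilon> = ((real r * sqrt (real p) + real s * sqrt (real q)) / 2) ^ 2"
    "\<bar>int p * int r ^ 2 - int q * int s ^ 2\<bar> = 4"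
proof -
  note result = that
  have sf: "squarefree (p * q)"
    using p q \<open>p \<noteq> q\<close> by (intro squarefree_mult_coprime) (auto simp: primes_coprime squarefree_prime)
  have "p * q > 1"
    using prime_gt_1_nat[OF p(1)] prime_gt_1_nat[OF q(1)] by (rule less_1_mult)
  obtain m n where mn: "\<epsilon> = (real m + real n * sqrt (real (p * q))) / 2"
      "m ^ 2 = p * q * n ^ 2 + 4" "n > 0"
    using fundamental_unit_pell[OF sf \<open>p * q > 1\<close> p _ \<epsilon>] by auto
  have "odd p" "odd q" using p(2) q(2) by presburger+
  have \<epsilon>_sqrt: "\<epsilon> = ((sqrt (real (m - 2)) + sqrt (real (m + 2))) / 2) ^ 2"
    using pell_sqrt[OF mn(2)] mn(1) by simp
  \<comment> \<open>Stated for two factors at distance 4, so that it serves odd \<open>u\<close>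
    directly and even \<open>u\<close> after rescaling.\<close>
  have finish: thesis
    if uv: "u + 4 = v" "m - 2 = u" "m + 2 = v"
      and rs: "(u = r ^ 2 \<and> v = p * q * s ^ 2) \<or> (u = p * q * r ^ 2 \<and> v = s ^ 2) \<or>
               (u = p * r ^ 2 \<and> v = q * s ^ 2) \<or> (u = q * r ^ 2 \<and> v = p * s ^ 2)"
      for u v r s
  proof -
    note eqs = \<epsilon>_sqrt[unfolded uv]
    from rs consider "u = r ^ 2" "v = p * q * s ^ 2" | "u = p * q * r ^ 2" "v = s ^ 2"
      | "u = p * r ^ 2" "v = q * s ^ 2" | "u = q * r ^ 2" "v = p * s ^ 2" by blast
    thus thesis
    proof cases
      case 1
      hence "p dvd r ^ 2 + 4" using uv(1) by simp
      thus ?thesis using not_prime_3mod4_dvd_square_plus[OF p] by blast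
    next
      case 2
      have "\<epsilon> = ((real s + real r * sqrt (p * q)) / 2) ^ 2"
        by (simp add: eqs 2 real_sqrt_mult mult_ac add.commute)
      moreover have "s ^ 2 = p * q * r ^ 2 + 4" using 2 uv(1) by simp
      ultimately have False using fundamental_unit_not_square[OF \<epsilon>] by blast
      thus ?thesis ..
    next
      case 3
      have "int (q * s ^ 2) = int (p * r ^ 2 + 4)" using 3 uv(1) by simp
      hence "\<bar>int p * int r ^ 2 - int q * int s ^ 2\<bar> = 4" by simp
      moreover have "\<epsilon> = ((real r * sqrt (real p) + real s * sqrt (real q)) / 2) ^ 2"
        by (simp add: eqs 3 real_sqrt_mult mult_ac)
      ultimately show ?thesis using result by blast
    next
      case 4
      have "int (p * s ^ 2) = int (q * r ^ 2 + 4)" using 4 uv(1) by simp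
      hence "\<bar>int p * int s ^ 2 - int q * int r ^ 2\<bar> = 4" by simp
      moreover have "\<epsilon> = ((real s * sqrt (real p) + real r * sqrt (real q)) / 2) ^ 2"
        by (simp add: eqs 4 real_sqrt_mult mult_ac add.commute)
      ultimately show ?thesis using result by blast
    qed
  qed
  have "m > 2"
  proof (rule ccontr)
    assume "\<not> m > 2"
    hence "m ^ 2 \<le> 2 ^ 2" by (intro power_mono) auto
    hence "m ^ 2 \<le> 4" by simp
    moreover have "p * q * n ^ 2 > 0"
      using p q mn(3) by (simp add: prime_gt_0_nat)
    ultimately show False using mn(2) by linarith
  qed
  define u where "u = m - 2"
  have m: "m = u + 2" using \<open>m > 2\<close> by (simp add: u_def)
  have uu: "u * (u + 4) = p * q * n ^ 2"
    using mn(2) by (simp add: m power2_eq_square algebra_simps)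
  show ?thesis
  proof (cases "odd u")
    case True
    from coprime_prod_two_primes_square[OF p(1) q(1) coprime_nat_add_2(2)[OF True] uu \<open>n > 0\<close>]
    show ?thesis using finish[of u "u + 4"] by (auto simp: m)
  next
    case False
    then obtain w where w: "u = 2 * w" by (auto elim!: evenE)
    have "even (p * q * n ^ 2)" using uu[symmetric] by (simp add: w)
    hence "even n" using \<open>odd p\<close> \<open>odd q\<close> by simp
    then obtain b where b: "n = 2 * b" by (auto elim!: evenE)
    have "4 * (w * (w + 2)) = 4 * (p * q * b ^ 2)"
      using uu by (simp add: w b power_mult_distrib algebra_simps)
    hence ww: "w * (w + 2) = p * q * b ^ 2" by simp
    \<comment> \<open>For odd \<open>w\<close> the left side of \<open>ww\<close> is 3 modulo 4,
      while the right side is 1 because \<open>b\<close> is then odd.\<close>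
    have "even w"
    proof (rule ccontr)
      assume "odd w"
      hence "odd (w * (w + 2))" by simp
      hence "odd b" unfolding ww by simp
      obtain j where j: "w = 2 * j + 1" using \<open>odd w\<close> by (elim oddE)
      have "w * (w + 2) = 3 + 4 * (j * j + 2 * j)"
        by (simp add: j algebra_simps)
      hence "(w * (w + 2)) mod 4 = 3"
        by (simp only: mod_mult_self2) simp
      moreover have "b ^ 2 mod 8 mod 4 = 1" by (simp add: square_mod_8_odd[OF \<open>odd b\<close>])
      hence "b ^ 2 mod 4 = 1" by (simp add: mod_mod_cancel)
      hence "[p * q * b ^ 2 = 3 * 3 * 1] (mod 4)"
        using p(2) q(2) by (intro cong_mult) (simp_all add: cong_def)
      hence "(p * q * b ^ 2) mod 4 = 1" by (simp add: cong_def)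
      ultimately show False using ww by simp
    qed
    then obtain k where k: "w = 2 * k" by (auto elim!: evenE)
    have "even (p * q * b ^ 2)" using ww[symmetric] by (simp add: k)
    hence "even b" using \<open>odd p\<close> \<open>odd q\<close> by simp
    then obtain c where c: "b = 2 * c" by (auto elim!: evenE)
    have "4 * (k * (k + 1)) = 4 * (p * q * c ^ 2)"
      using ww by (simp add: k c power_mult_distrib algebra_simps)
    hence kk: "k * (k + 1) = p * q * c ^ 2" by simp
    have "c > 0" using \<open>n > 0\<close> by (simp add: b c)
    obtain r s where rs: "(k = r ^ 2 \<and> k + 1 = p * q * s ^ 2) \<or> (k = p * q * r ^ 2 \<and> k + 1 = s ^ 2) \<or>
               (k = p * r ^ 2 \<and> k + 1 = q * s ^ 2) \<or> (k = q * r ^ 2 \<and> k + 1 = p * s ^ 2)"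
      using coprime_prod_two_primes_square[OF p(1) q(1) _ kk \<open>c > 0\<close>] by auto
    show ?thesis
    \<comment> \<open>Scaling \<open>k\<close> and \<open>k + 1\<close> by 4 doubles
      \<open>r\<close> and \<open>s\<close> and restores the distance 4.\<close>
    proof (rule finish[of "4 * k" "4 * (k + 1)" "2 * r" "2 * s"])
      show "4 * k = (2 * r)\<^sup>2 \<and> 4 * (k + 1) = p * q * (2 * s)\<^sup>2 \<or>
            4 * k = p * q * (2 * r)\<^sup>2 \<and> 4 * (k + 1) = (2 * s)\<^sup>2 \<or>
            4 * k = p * (2 * r)\<^sup>2 \<and> 4 * (k + 1) = q * (2 * s)\<^sup>2 \<or>
            4 * k = q * (2 * r)\<^sup>2 \<and> 4 * (k + 1) = p * (2 * s)\<^sup>2"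
        using rs unfolding power_mult_distrib by (elim disjE conjE) (simp_all only: mult_ac, auto)
    qed (auto simp: m w k)
  qed
qed

section \<open>Dimension over the field with two elements\<close>

lemma UNIV_bit: "(UNIV :: bit set) = {0, 1}"
  using bit_not_one_iff by auto

lemma bit_add_self: "(x :: bit) + x = 0"
  by (cases x) simp_all

text \<open>Counting replaces linear algebra: if \<open>r > n\<close>, two of the
  \<open>2 ^ r\<close> coefficient vectors yield the same coordinates in terms of \<open>g\<close>,
  and their sum is a nontrivial relation among the \<open>v i\<close>.\<close>

lemma f2_independent_le:
  fixes g :: "nat \<Rightarrow> 'e \<Rightarrow> bit"
  assumes ind: "f2_independent E r v"
    and span: "\<And>i. i < r \<Longrightarrow> \<exists>c. \<forall>x\<in>E. v i x = (\<Sum>j<n. c j * g j x)"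
  shows "r \<le> n"
proof (rule ccontr)
  assume "\<not> r \<le> n"
  hence "n < r" by simp
  obtain M where M: "\<And>i x. i < r \<Longrightarrow> x \<in> E \<Longrightarrow> v i x = (\<Sum>j<n. M i j * g j x)"
    using span by metis
  define C where "C = (\<lambda>k :: nat. PiE {..<k} (\<lambda>_. UNIV :: bit set))"
  have card: "card (C k) = 2 ^ k" for k
    by (simp add: C_def card_PiE UNIV_bit numeral_2_eq_2)
  have fin: "finite (C k)" for k
    by (auto simp: C_def UNIV_bit intro: finite_PiE)
  \<comment> \<open>\<open>F\<close> sends the coefficients of a combination of the
    \<open>v i\<close> to its coefficients in terms of the \<open>g j\<close>; restriction makes
    source and target finite sets of functions.\<close>
  define F where "F = (\<lambda>c :: nat \<Rightarrow> bit. restrict (\<lambda>j. \<Sum>i<r. c i * M i j) {..<n})"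
  have "F ` C r \<subseteq> C n"
    unfolding F_def C_def by (intro image_subsetI) simp
  hence "card (F ` C r) \<le> 2 ^ n"
    using card_mono[OF fin] card by metis
  also have "\<dots> < card (C r)"
    using \<open>n < r\<close> by (simp add: card)
  finally have "\<not> inj_on F (C r)"
    by (rule pigeonhole)
  then obtain c c' where cc: "c \<in> C r" "c' \<in> C r" "c \<noteq> c'" "F c = F c'"
    by (auto simp: inj_on_def)
  have F: "(\<Sum>i<r. (c i + c' i) * M i j) = 0" if "j < n" for j
  proof -
    have "(\<Sum>i<r. c i * M i j) = (\<Sum>i<r. c' i * M i j)"
      using fun_cong[OF cc(4), of j] that by (simp add: F_def)
    moreover have "(\<Sum>i<r. (c i + c' i) * M i j) = (\<Sum>i<r. c i * M i j) + (\<Sum>i<r. c' i * M i j)"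
      by (simp only: ring_distribs sum.distrib)
    ultimately show ?thesis
      by (metis bit_add_self)
  qed
  have "(\<Sum>i<r. (c i + c' i) * v i x) = 0" if "x \<in> E" for x
  proof -
    have "(\<Sum>i<r. (c i + c' i) * v i x) = (\<Sum>i<r. \<Sum>j<n. (c i + c' i) * M i j * g j x)"
      by (rule sum.cong) (use M that in \<open>simp_all only: sum_distrib_left mult.assoc lessThan_iff\<close>)
    also have "\<dots> = (\<Sum>j<n. (\<Sum>i<r. (c i + c' i) * M i j) * g j x)"
      by (subst sum.swap) (simp only: sum_distrib_right)
    also have "\<dots> = 0"
      by (intro sum.neutral ballI) (metis F lessThan_iff mult_zero_left)
    finally show ?thesis .
  qed
  hence "\<forall>x\<in>E. (\<Sum>i<r. (c i + c' i) * v i x) = 0"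
    by (rule ballI)
  with ind[unfolded f2_independent_def, THEN spec[of _ "\<lambda>i. c i + c' i"]]
  have "\<forall>i<r. c i + c' i = 0"
    by (rule mp)
  hence "c i = c' i" if "i < r" for i
    using that by (cases "c i"; cases "c' i") auto
  hence "c = c'"
    using cc(1,2) by (intro PiE_ext[of c "{..<r}" _ c']) (auto simp: C_def)
  thus False using cc(3) by simp
qed

text \<open>The bound \<open>r \<le> n\<close> serves twice: it makes the set of admissible
  \<open>r\<close> finite, so that \<open>Max\<close> is meaningful, and it identifies
  \<open>n\<close> as the maximum.\<close>

lemma f2_dim_eqI:
  fixes g :: "nat \<Rightarrow> 'e \<Rightarrow> bit"
  assumes "\<And>i. i < n \<Longrightarrow> g i \<in> S" "f2_independent E n g"
    and "\<And>s. s \<in> S \<Longrightarrow> \<exists>c. \<forall>x\<in>E. s x = (\<Sum>j<n. c j * g j x)"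
  shows "f2_dim E S = n"
proof -
  define R where "R = {r. \<exists>v. (\<forall>i<r. v i \<in> S) \<and> f2_independent E r v}"
  have le: "r \<le> n" if "r \<in> R" for r
  proof -
    obtain v where v: "\<And>i. i < r \<Longrightarrow> v i \<in> S" "f2_independent E r v"
      using \<open>r \<in> R\<close> by (auto simp: R_def)
    show ?thesis
      by (rule f2_independent_le[OF v(2) assms(3)[OF v(1)]])
  qed
  hence "finite R"
    by (intro finite_subset[of R "{..n}"]) auto
  moreover have "n \<in> R"
    using assms(1,2) by (auto simp: R_def)
  ultimately have "Max R = n"
    using le by (intro Max_eqI) auto
  thus ?thesis by (simp add: f2_dim_def R_def)
qed

text \<open>The sign character written additively: on nonzero reals it turns products into sums over
  the field with two elements.\<close>

definition neg_bit :: "real \<Rightarrow> bit" where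
  "neg_bit x = (if x < 0 then 1 else 0)"

lemma neg_bit_mult: "x \<noteq> 0 \<Longrightarrow> y \<noteq> 0 \<Longrightarrow> neg_bit (x * y) = neg_bit x + neg_bit y"
  by (auto simp: neg_bit_def mult_less_0_iff)

lemma neg_bit_powi: "x \<noteq> 0 \<Longrightarrow> neg_bit (x powi k) = of_int k * neg_bit x"
proof -
  assume x: "x \<noteq> 0"
  have pow: "neg_bit (y ^ n) = of_nat n * neg_bit y" if "y \<noteq> 0" for y n
    using that by (induction n) (auto simp: neg_bit_mult ring_distribs, simp add: neg_bit_def)
  have inv: "neg_bit (inverse y) = neg_bit y" for y
    by (simp add: neg_bit_def)
  show ?thesis
  proof (cases "k \<ge> 0")
    case True
    hence "of_nat (nat k) = (of_int k :: bit)" by simp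
    thus ?thesis using True pow[OF x, of "nat k"] by (simp only: power_int_def if_True)
  next
    case False
    \<comment> \<open>Negating an exponent does not change its parity.\<close>
    have "of_nat (nat (- k)) = (of_int k :: bit)"
      using False by (cases "of_int k :: bit") auto
    thus ?thesis using False x by (simp add: power_int_def pow inv)
  qed
qed

section \<open>Real roots of unity and powers of a fundamental unit\<close>

lemma real_root_of_unity:
  fixes z :: real
  assumes "z ^ n = 1" "n > 0"
  shows "z = 1 \<or> z = - 1"
proof -
  have "\<bar>z\<bar> ^ n = 1 ^ n"
    using assms(1) by (simp flip: power_abs)
  hence "\<bar>z\<bar> = 1"
    using assms(2) by (intro power_eq_imp_eq_base[of "\<bar>z\<bar>" n 1]) auto
  thus ?thesis by linarith
qed

lemma real_powi_eq_1:
  fixes x :: real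
  assumes "x > 1" "x powi k = 1"
  shows "k = 0"
proof (rule ccontr)
  assume "k \<noteq> 0"
  hence "x powi k < x powi 0 \<or> x powi 0 < x powi k"
    using assms(1) by (metis linorder_neqE_linordered_idom power_int_strict_increasing)
  thus False using assms(2) by simp
qed

lemma powi_fundamental_domain:
  fixes x u :: real
  assumes "x > 1" "u > 0"
  obtains k :: int where "x powi k \<le> u" "u < x powi (k + 1)"
proof -
  define k where "k = \<lfloor>log x u\<rfloor>"
  have pw: "x powr of_int j = x powi j" for j
    using assms(1) by (simp add: powr_real_of_int')
  have "x powr of_int k \<le> x powr (log x u)"
    using assms by (intro powr_mono) (auto simp: k_def)
  moreover have "x powr (log x u) < x powr of_int (k + 1)"
    using assms by (intro powr_less_mono) (auto simp: k_def)
  ultimately show ?thesis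
    using assms that[of k] by (simp only: pw) simp
qed

text \<open>A suitable power of \<open>\<epsilon>\<close> moves a positive unit into the interval
  from 1 to \<open>\<epsilon>\<close>, with \<open>\<epsilon>\<close> excluded; minimality leaves
  only 1.\<close>

lemma fundamental_unit_generates:
  fixes d :: nat
  assumes \<epsilon>: "is_fundamental_unit (real d) \<epsilon>" and u: "u \<in> units_of_field (quad_field (real d))"
  obtains k :: int where "u = \<epsilon> powi k \<or> u = - (\<epsilon> powi k)"
proof -
  interpret real_subring "quad_field (real d)" by (rule quad_subring)
  have gt: "\<epsilon> > 1" and \<epsilon>_unit: "\<epsilon> \<in> units_of_field (quad_field (real d))"
    and least: "\<And>w. w \<in> units_of_field (quad_field (real d)) \<Longrightarrow> w > 1 \<Longrightarrow> \<epsilon> \<le> w"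
    using \<epsilon> by (auto simp: is_fundamental_unit_def)
  have pos: "\<exists>k. v = \<epsilon> powi k" if v: "v \<in> units_of_field (quad_field (real d))" "v > 0" for v
  proof -
    obtain k where k: "\<epsilon> powi k \<le> v" "v < \<epsilon> powi (k + 1)"
      using powi_fundamental_domain[OF gt v(2)] by blast
    define w where "w = v * \<epsilon> powi (- k)"
    have vw: "v = w * \<epsilon> powi k"
      using gt by (simp add: w_def power_int_minus)
    have pk: "\<epsilon> powi k > 0" using gt by simp
    have "w \<ge> 1" "w < \<epsilon>"
      using k gt pk by (simp_all add: vw power_int_add mult.commute)
    moreover have "w \<in> units_of_field (quad_field (real d))"
      unfolding w_def by (intro unit_mult unit_powi v \<epsilon>_unit)
    ultimately have "w = 1"
      using least[of w] by fastforce
    thus ?thesis using vw by auto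
  qed
  have "u \<noteq> 0" using u by (simp add: units_of_field_def)
  hence "u > 0 \<or> - u > 0" by auto
  hence "\<exists>k. u = \<epsilon> powi k \<or> u = - (\<epsilon> powi k)"
    using pos[OF u] pos[OF unit_minus[OF u]] by (metis minus_minus)
  thus ?thesis using that by blast
qed

section \<open>The biquadratic field and its conjugations\<close>

text \<open>The roots stay parameters \<open>x\<close>, \<open>y\<close>, so that fixed rational
  coordinates can be evaluated at conjugate roots.\<close>

definition bq :: "real \<Rightarrow> real \<Rightarrow> real \<Rightarrow> real \<Rightarrow> real \<Rightarrow> real \<Rightarrow> real" where
  "bq x y a b c e = a + b * x + c * y + e * (x * y)"

lemma bq_add: "bq x y a b c e + bq x y a' b' c' e' = bq x y (a + a') (b + b') (c + c') (e + e')"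
  by (simp add: bq_def algebra_simps)

lemma bq_minus: "- bq x y a b c e = bq x y (- a) (- b) (- c) (- e)"
  by (simp add: bq_def algebra_simps)

lemma bq_mult:
  assumes "x * x = d1" "y * y = d2"
  shows "bq x y a b c e * bq x y a' b' c' e' =
    bq x y (a * a' + d1 * (b * b') + d2 * (c * c') + d1 * d2 * (e * e'))
           (a * b' + b * a' + d2 * (c * e' + e * c'))
           (a * c' + c * a' + d1 * (b * e' + e * b'))
           (a * e' + e * a' + b * c' + c * b')"
  unfolding bq_def assms[symmetric] by (simp add: algebra_simps)

locale biquad =
  fixes q1 q2 :: nat
  assumes q1: "prime q1" and q2: "prime q2" and distinct: "q1 \<noteq> q2"
begin

abbreviation "s1 \<equiv> sqrt (real q1)"
abbreviation "s2 \<equiv> sqrt (real q2)"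
abbreviation "K \<equiv> biquad_field (real q1) (real q2)"

lemma K_eq: "K = {bq s1 s2 a b c e | a b c e. a \<in> \<rat> \<and> b \<in> \<rat> \<and> c \<in> \<rat> \<and> e \<in> \<rat>}"
  by (simp add: biquad_field_def bq_def real_sqrt_mult)

lemma K_cases:
  assumes "u \<in> K"
  obtains a b c e where "a \<in> \<rat>" "b \<in> \<rat>" "c \<in> \<rat>" "e \<in> \<rat>" "u = bq s1 s2 a b c e"
  using assms by (auto simp: K_eq)

lemma pos: "s1 > 0" "s2 > 0"
  using q1 q2 by (auto simp: prime_gt_0_nat)

lemma irrational: "s1 \<notin> \<rat>" "s2 \<notin> \<rat>" "s1 * s2 \<notin> \<rat>"
proof -
  show "s1 \<notin> \<rat>" "s2 \<notin> \<rat>"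
    using sqrt_squarefree_irrational[OF squarefree_prime[OF q1] prime_gt_1_nat[OF q1]]
      sqrt_squarefree_irrational[OF squarefree_prime[OF q2] prime_gt_1_nat[OF q2]] by auto
  have "squarefree (q1 * q2)"
    using q1 q2 distinct by (intro squarefree_mult_coprime) (auto simp: primes_coprime squarefree_prime)
  moreover have "q1 * q2 > 1"
    using q1 q2 by (intro less_1_mult prime_gt_1_nat)
  ultimately show "s1 * s2 \<notin> \<rat>"
    using sqrt_squarefree_irrational[of "q1 * q2"] by (simp add: real_sqrt_mult)
qed

text \<open>Squaring shows \<open>a * b = 0\<close> by irrationality of \<open>s1\<close>, and then
  \<open>s1 * s2\<close> or \<open>s2\<close> would be rational.\<close>

lemma s2_not_in_quad:
  assumes "a \<in> \<rat>" "b \<in> \<rat>"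
  shows "s2 \<noteq> a + b * s1"
proof
  assume eq: "s2 = a + b * s1"
  have "s2 * s2 = (a + b * s1) * (a + b * s1)" by (simp only: eq)
  hence "real q2 = (a * a + b * b * q1) + (a * b + b * a) * s1"
    by (subst (asm) quad_mult[of s1 q1]) auto
  hence "(a * a + b * b * q1 - q2) + (2 * (a * b)) * s1 = 0" by (simp add: algebra_simps)
  from quad_coords_zero[OF irrational(1) _ _ this] assms have "a = 0 \<or> b = 0" by auto
  thus False
  proof
    assume "a = 0"
    hence "s1 * s2 = b * q1" by (simp add: eq)
    thus False using irrational(3) assms by auto
  next
    assume "b = 0"
    thus False using irrational(2) assms eq by auto
  qed
qed

text \<open>Grouped as a combination of 1 and \<open>s2\<close> over the first quadratic field, a
  nonzero coefficient of \<open>s2\<close> could be divided out, contradicting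
  \<open>s2_not_in_quad\<close>.\<close>

lemma bq_zero:
  assumes "a \<in> \<rat>" "b \<in> \<rat>" "c \<in> \<rat>" "e \<in> \<rat>" "bq s1 s2 a b c e = 0"
  shows "a = 0 \<and> b = 0 \<and> c = 0 \<and> e = 0"
proof -
  have eq: "(a + b * s1) + (c + e * s1) * s2 = 0"
    using assms(5) by (simp add: bq_def algebra_simps)
  have "c + e * s1 = 0"
  proof (rule ccontr)
    assume nz: "c + e * s1 \<noteq> 0"
    \<comment> \<open>The norm of the coefficient of \<open>s2\<close>; multiplying by the conjugate
      makes the denominator rational.\<close>
    define N where "N = c * c - e * e * q1"
    have N: "(c + e * s1) * (c - e * s1) = N"
      using quad_mult[of s1 q1 c e c "- e"] by (simp add: N_def)
    have nz': "c - e * s1 \<noteq> 0"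
    proof
      assume "c - e * s1 = 0"
      hence "c = 0 \<and> e = 0"
        using quad_coords_zero[OF irrational(1), of c "- e"] assms by simp
      thus False using nz by simp
    qed
    hence "N \<noteq> 0" using N nz by auto
    have "N * s2 = - ((a + b * s1) * (c - e * s1))"
      using eq unfolding N[symmetric] by (metis add_eq_0_iff mult.assoc mult.commute mult_minus_left)
    also have "(a + b * s1) * (c - e * s1) = (a * c - b * e * q1) + (b * c - a * e) * s1"
      using quad_mult[of s1 q1 a b c "- e"] by (simp add: algebra_simps)
    also have "- (X + Y * s1) = N * (- X / N + - Y / N * s1)" for X Y
      using \<open>N \<noteq> 0\<close> by (simp add: field_simps)
    finally have "s2 = (- (a * c - b * e * q1) / N) + (- (b * c - a * e) / N) * s1"
      using \<open>N \<noteq> 0\<close> by (simp only: mult_cancel_left) simp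
    moreover have "N \<in> \<rat>" using assms by (simp add: N_def)
    hence "- (a * c - b * e * q1) / N \<in> \<rat>" "- (b * c - a * e) / N \<in> \<rat>"
      using assms(1-4) by simp_all
    ultimately show False
      using s2_not_in_quad by blast
  qed
  with eq have "a + b * s1 = 0" by simp
  thus ?thesis
    using quad_coords_zero[OF irrational(1), of a b] quad_coords_zero[OF irrational(1), of c e]
      assms \<open>c + e * s1 = 0\<close> by auto
qed

lemma bq_inject:
  assumes "a \<in> \<rat>" "b \<in> \<rat>" "c \<in> \<rat>" "e \<in> \<rat>" "a' \<in> \<rat>" "b' \<in> \<rat>" "c' \<in> \<rat>" "e' \<in> \<rat>"
    and "bq s1 s2 a b c e = bq s1 s2 a' b' c' e'"
  shows "a = a' \<and> b = b' \<and> c = c' \<and> e = e'"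
proof -
  have "bq s1 s2 (a - a') (b - b') (c - c') (e - e') = 0"
    using assms(9) by (simp add: bq_def algebra_simps)
  thus ?thesis using bq_zero[of "a - a'" "b - b'" "c - c'" "e - e'"] assms by simp
qed

lemma K_ringI: "a \<in> \<rat> \<Longrightarrow> b \<in> \<rat> \<Longrightarrow> c \<in> \<rat> \<Longrightarrow> e \<in> \<rat> \<Longrightarrow> bq s1 s2 a b c e \<in> K"
  by (auto simp: K_eq)

sublocale real_subring K
proof
  show "1 \<in> K" using K_ringI[of 1 0 0 0] by (simp add: bq_def)
  show "- x \<in> K" if "x \<in> K" for x
    using that by (elim K_cases) (auto simp: bq_minus intro!: K_ringI)
  show "x * y \<in> K" if "x \<in> K" "y \<in> K" for x y
    using that by (elim K_cases) (auto simp: bq_mult[of _ q1 _ q2] intro!: K_ringI)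
qed

lemma add_closed: "x \<in> K \<Longrightarrow> y \<in> K \<Longrightarrow> x + y \<in> K"
  by (elim K_cases) (auto simp: bq_add intro!: K_ringI)

lemma Rats_in_K: "a \<in> \<rat> \<Longrightarrow> a \<in> K"
  using K_ringI[of a 0 0 0] by (simp add: bq_def)

lemma s_in_K: "s1 \<in> K" "s2 \<in> K"
  using K_ringI[of 0 1 0 0] K_ringI[of 0 0 1 0] by (simp_all add: bq_def)

section \<open>The four conjugations of \<open>K\<close>, defined by substitution in
  coordinates\<close>

definition emb :: "real \<Rightarrow> real \<Rightarrow> real \<Rightarrow> real" where
  "emb x y u = (if u \<in> K then THE v. \<exists>a\<in>\<rat>. \<exists>b\<in>\<rat>. \<exists>c\<in>\<rat>. \<exists>e\<in>\<rat>.
     u = bq s1 s2 a b c e \<and> v = bq x y a b c e else 0)"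

text \<open>By \<open>bq_inject\<close> the coordinates are unique, so the description in
  \<open>emb\<close> denotes a single value.\<close>

lemma emb_bq:
  assumes "a \<in> \<rat>" "b \<in> \<rat>" "c \<in> \<rat>" "e \<in> \<rat>"
  shows "emb x y (bq s1 s2 a b c e) = bq x y a b c e"
proof -
  have "(THE v. \<exists>a'\<in>\<rat>. \<exists>b'\<in>\<rat>. \<exists>c'\<in>\<rat>. \<exists>e'\<in>\<rat>.
     bq s1 s2 a b c e = bq s1 s2 a' b' c' e' \<and> v = bq x y a' b' c' e') = bq x y a b c e"
    using assms by (intro the_equality) (blast, metis bq_inject)
  thus ?thesis using K_ringI[OF assms] by (simp add: emb_def)
qed

lemma emb_id: "u \<in> K \<Longrightarrow> emb s1 s2 u = u"
  by (elim K_cases) (simp add: emb_bq)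

lemma emb_add: "u \<in> K \<Longrightarrow> v \<in> K \<Longrightarrow> emb x y (u + v) = emb x y u + emb x y v"
  by (elim K_cases) (simp add: bq_add emb_bq)

lemma emb_Rats: "a \<in> \<rat> \<Longrightarrow> emb x y a = a"
  using emb_bq[of a 0 0 0 x y] by (simp add: bq_def)

lemma emb_s: "emb x y s1 = x" "emb x y s2 = y"
  using emb_bq[of 0 1 0 0 x y] emb_bq[of 0 0 1 0 x y] by (simp_all add: bq_def)

definition signs :: "(real \<times> real) set" where
  "signs = {(s1, s2), (- s1, s2), (s1, - s2), (- s1, - s2)}"

lemma signs_square:
  assumes "(x, y) \<in> signs"
  shows "x * x = real q1" "y * y = real q2"
  using assms by (auto simp: signs_def)

text \<open>The multiplication table in \<open>bq_mult\<close> depends only on the squares of the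
  roots, which every sign choice preserves.\<close>

lemma emb_mult:
  assumes "(x, y) \<in> signs" "u \<in> K" "v \<in> K"
  shows "emb x y (u * v) = emb x y u * emb x y v"
proof -
  note sq = signs_square[OF assms(1)]
  have "s1 * s1 = real q1" "s2 * s2 = real q2" by simp_all
  note sq' = bq_mult[OF this] bq_mult[OF sq]
  show ?thesis
    using assms(2,3) by (elim K_cases) (simp only: sq', subst emb_bq, auto simp: emb_bq sq')
qed

lemma emb_closed:
  assumes "(x, y) \<in> signs" "u \<in> K"
  shows "emb x y u \<in> K"
proof -
  obtain a b c e where *: "a \<in> \<rat>" "b \<in> \<rat>" "c \<in> \<rat>" "e \<in> \<rat>" "u = bq s1 s2 a b c e"
    using assms(2) by (rule K_cases)
  have "emb x y u \<in> {bq s1 s2 a b c e, bq s1 s2 a (- b) c (- e),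
     bq s1 s2 a b (- c) (- e), bq s1 s2 a (- b) (- c) e}"
    using assms(1) * by (auto simp: signs_def emb_bq) (auto simp: bq_def)
  thus ?thesis using * by (auto intro!: K_ringI)
qed

lemma emb_zero_iff:
  assumes "(x, y) \<in> signs" "u \<in> K"
  shows "emb x y u = 0 \<longleftrightarrow> u = 0"
proof
  assume "emb x y u = 0"
  obtain a b c e where *: "a \<in> \<rat>" "b \<in> \<rat>" "c \<in> \<rat>" "e \<in> \<rat>" "u = bq s1 s2 a b c e"
    using assms(2) by (rule K_cases)
  have "bq s1 s2 a b c e = 0 \<or> bq s1 s2 a (- b) c (- e) = 0 \<or>
     bq s1 s2 a b (- c) (- e) = 0 \<or> bq s1 s2 a (- b) (- c) e = 0"
    using assms(1) * \<open>emb x y u = 0\<close> by (auto simp: signs_def emb_bq) (auto simp: bq_def)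
  hence "a = 0 \<and> b = 0 \<and> c = 0 \<and> e = 0"
    using * bq_zero[of a b c e] bq_zero[of a "- b" c "- e"] bq_zero[of a b "- c" "- e"]
      bq_zero[of a "- b" "- c" e] by auto
  thus "u = 0" by (simp add: * bq_def)
qed (simp add: emb_Rats)

lemma emb_algebraic_int:
  assumes "(x, y) \<in> signs" "u \<in> K" "algebraic_int u"
  shows "algebraic_int (emb x y u)"
proof (rule algebraic_int_graph[of "(\<lambda>v. (v, emb x y v)) ` K"])
  fix v w v' w'
  assume "(v, v') \<in> (\<lambda>v. (v, emb x y v)) ` K" "(w, w') \<in> (\<lambda>v. (v, emb x y v)) ` K"
  hence vw: "v \<in> K" "w \<in> K" "v' = emb x y v" "w' = emb x y w" by auto
  show "(v + w, v' + w') \<in> (\<lambda>v. (v, emb x y v)) ` K"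
    using vw by (intro image_eqI[of _ _ "v + w"]) (auto simp: emb_add add_closed)
  show "(v * w, v' * w') \<in> (\<lambda>v. (v, emb x y v)) ` K"
    using vw assms(1) by (intro image_eqI[of _ _ "v * w"]) (auto simp: emb_mult mult_closed)
next
  show "(of_int k, of_int k) \<in> (\<lambda>v. (v, emb x y v)) ` K" for k
    by (intro image_eqI[of _ _ "of_int k"]) (auto simp: emb_Rats Rats_in_K)
qed (use assms emb_Rats[of 0] in auto)

lemma emb_unit:
  assumes "(x, y) \<in> signs" "u \<in> units_of_field K"
  shows "emb x y u \<in> units_of_field K" "emb x y (inverse u) = inverse (emb x y u)" "emb x y u \<noteq> 0"
proof -
  have u: "u \<in> K" "inverse u \<in> K" "u \<noteq> 0" "algebraic_int u" "algebraic_int (inverse u)"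
    using assms(2) by (auto simp: units_of_field_def ring_of_integers_def)
  have "emb x y u * emb x y (inverse u) = emb x y (u * inverse u)"
    using emb_mult[OF assms(1) u(1,2)] by simp
  also have "\<dots> = 1" using u emb_Rats[of 1] by simp
  finally show inv: "emb x y (inverse u) = inverse (emb x y u)"
    by (simp add: inverse_unique)
  show nz: "emb x y u \<noteq> 0" using emb_zero_iff[OF assms(1) u(1)] u by simp
  show "emb x y u \<in> units_of_field K"
    using nz u assms emb_closed emb_algebraic_int
    by (auto simp: units_of_field_def ring_of_integers_def inv[symmetric])
qed

lemma emb_powi:
  assumes "(x, y) \<in> signs" "u \<in> units_of_field K"
  shows "emb x y (u powi k) = emb x y u powi k"
proof -
  have pow: "emb x y (v ^ n) = emb x y v ^ n" if "v \<in> units_of_field K" for v n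
  proof (induction n)
    case (Suc n)
    have "v \<in> K" "v ^ n \<in> K"
      using that unit_power[OF that, of n] by (auto simp: units_of_field_def ring_of_integers_def)
    thus ?case using Suc by (simp add: emb_mult[OF assms(1)])
  qed (simp add: emb_Rats)
  show ?thesis
    using pow[OF assms(2)] pow[OF unit_inverse[OF assms(2)]] emb_unit(2)[OF assms]
    by (simp add: power_int_def)
qed

end

section \<open>Relative norms\<close>

lemma units_of_field_mono: "L \<subseteq> K \<Longrightarrow> units_of_field L \<subseteq> units_of_field K"
  by (auto simp: units_of_field_def ring_of_integers_def)

text \<open>Such a \<open>w\<close> would make \<open>2 * m\<close> the square of the rational
  number \<open>w * m\<close>, although \<open>2 * m\<close> is squarefree.\<close>

lemma two_not_rational_multiple_square:
  fixes m :: nat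
  assumes "squarefree m" "odd m" "w \<in> \<rat>"
  shows "w * w * real m \<noteq> 2"
proof
  assume *: "w * w * real m = 2"
  have "squarefree (2 * m)"
    using assms(1,2) by (intro squarefree_mult_coprime) (auto simp: squarefree_prime)
  moreover have "2 * m > 1" using assms(2) by (cases m) auto
  ultimately have "sqrt (real (2 * m)) \<notin> \<rat>" by (rule sqrt_squarefree_irrational)
  moreover have "real (2 * m) = (w * real m) ^ 2"
    using * by (simp add: power2_eq_square mult_ac)
  hence "sqrt (real (2 * m)) = \<bar>w * real m\<bar>" by simp
  ultimately show False using assms(3) by (simp add: abs_if split: if_splits)
qed

context biquad
begin

text \<open>An embedding fixes the rationals, so it is determined by the images of \<open>s1\<close>
  and \<open>s2\<close>, which must have the same squares as these roots.\<close>

lemma real_embeddings_eq: "real_embeddings K = (\<lambda>(x, y). emb x y) ` signs"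
proof (intro equalityI subsetI)
  fix \<sigma> assume "\<sigma> \<in> real_embeddings K"
  hence add: "\<And>u v. u \<in> K \<Longrightarrow> v \<in> K \<Longrightarrow> \<sigma> (u + v) = \<sigma> u + \<sigma> v"
    and mult: "\<And>u v. u \<in> K \<Longrightarrow> v \<in> K \<Longrightarrow> \<sigma> (u * v) = \<sigma> u * \<sigma> v"
    and one: "\<sigma> 1 = 1" and out: "\<And>u. u \<notin> K \<Longrightarrow> \<sigma> u = 0"
    by (auto simp: real_embeddings_def)
  have zero: "\<sigma> 0 = 0" using add[of 0 0] Rats_in_K[of 0] by simp
  have nat: "\<sigma> (of_nat n) = of_nat n" for n
    by (induction n) (simp_all add: zero one add Rats_in_K)
  have int: "\<sigma> (of_int k) = of_int k" for k
  proof (cases "k \<ge> 0")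
    case True
    thus ?thesis using nat[of "nat k"] by simp
  next
    case False
    have "\<sigma> (of_int k + of_nat (nat (- k))) = \<sigma> (of_int k) + of_nat (nat (- k))"
      by (simp add: add Rats_in_K nat)
    thus ?thesis using False zero by simp
  qed
  have rat: "\<sigma> a = a" if a: "a \<in> \<rat>" for a
  proof -
    from a obtain p q :: int where "q > 0" "coprime p q" "a = of_int p / of_int q"
      by (rule Rats_cases')
    hence pq: "q \<noteq> 0" "a = of_int p / of_int q" by auto
    have aq: "a * of_int q = of_int p" using pq by simp
    have "\<sigma> a * of_int q = \<sigma> (a * of_int q)"
      using mult[of a "of_int q"] int a by (simp add: Rats_in_K)
    also have "\<dots> = a * of_int q" unfolding aq by (rule int)
    finally show ?thesis using pq(1) by simp
  qed
  have "\<sigma> s1 * \<sigma> s1 = s1 * s1" "\<sigma> s2 * \<sigma> s2 = s2 * s2"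
    using mult[OF s_in_K(1) s_in_K(1)] mult[OF s_in_K(2) s_in_K(2)] nat by simp_all
  hence "\<sigma> s1 = s1 \<or> \<sigma> s1 = - s1" "\<sigma> s2 = s2 \<or> \<sigma> s2 = - s2"
    by (simp_all only: square_eq_iff)
  hence sgn: "(\<sigma> s1, \<sigma> s2) \<in> signs"
    unfolding signs_def by blast
  have "\<sigma> u = emb (\<sigma> s1) (\<sigma> s2) u" for u
  proof (cases "u \<in> K")
    case True
    then obtain a b c e where *: "a \<in> \<rat>" "b \<in> \<rat>" "c \<in> \<rat>" "e \<in> \<rat>" "u = bq s1 s2 a b c e"
      by (rule K_cases)
    have "\<sigma> u = bq (\<sigma> s1) (\<sigma> s2) a b c e"
      unfolding *(5) bq_def using *(1-4)
      by (simp add: add mult rat Rats_in_K s_in_K add_closed mult_closed)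
    thus ?thesis using * by (simp add: emb_bq)
  qed (simp add: out emb_def)
  hence \<sigma>: "\<sigma> = emb (\<sigma> s1) (\<sigma> s2)" by (rule ext)
  show "\<sigma> \<in> (\<lambda>(x, y). emb x y) ` signs"
    by (rule image_eqI[OF _ sgn]) (unfold prod.case, rule \<sigma>)
next
  fix \<sigma> assume "\<sigma> \<in> (\<lambda>(x, y). emb x y) ` signs"
  thus "\<sigma> \<in> real_embeddings K"
    by (auto simp: real_embeddings_def emb_add emb_mult emb_Rats) (auto simp: emb_def)
qed

lemma card_real_embeddings: "card (real_embeddings K) = 4"
proof -
  have "inj_on (\<lambda>(x, y). emb x y) signs"
    by (rule inj_onI) (metis (no_types, lifting) case_prod_conv emb_s surj_pair)
  moreover have "card signs = 4"
    using pos by (simp add: signs_def)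
  ultimately show ?thesis
    unfolding real_embeddings_eq by (simp add: card_image)
qed

text \<open>Each product is invariant under one nontrivial conjugation, so only the coordinates of
  the corresponding quadratic subfield survive.\<close>

lemma norm_in_quad:
  assumes "u \<in> K"
  shows "emb s1 s2 u * emb s1 (- s2) u \<in> quad_field (real q1)"
    and "emb s1 s2 u * emb (- s1) s2 u \<in> quad_field (real q2)"
    and "emb s1 (- s2) u * emb (- s1) s2 u \<in> quad_field (real (q1 * q2))"
proof -
  obtain a b c e where *: "a \<in> \<rat>" "b \<in> \<rat>" "c \<in> \<rat>" "e \<in> \<rat>" "u = bq s1 s2 a b c e"
    using assms by (rule K_cases)
  have sq: "s1 * s1 = q1" "s2 * s2 = q2" by simp_all
  have "bq x y a b c e * bq x (- y) a b c e =
      (a * a + d1 * b * b - d2 * c * c - d1 * d2 * e * e) + (2 * a * b - 2 * d2 * c * e) * x"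
    "bq x y a b c e * bq (- x) y a b c e =
      (a * a - d1 * b * b + d2 * c * c - d1 * d2 * e * e) + (2 * a * c - 2 * d1 * b * e) * y"
    "bq x (- y) a b c e * bq (- x) y a b c e =
      (a * a - d1 * b * b - d2 * c * c + d1 * d2 * e * e) + (2 * b * c - 2 * a * e) * (x * y)"
    if "x * x = d1" "y * y = d2" for x y d1 d2
    unfolding that[symmetric] bq_def by (simp_all add: algebra_simps)
  note norm = this[OF sq]
  show "emb s1 s2 u * emb s1 (- s2) u \<in> quad_field (real q1)"
    unfolding *(5) emb_bq[OF *(1-4)] norm quad_field_def
    by (rule CollectI, rule exI, rule exI, rule conjI, rule refl) (use * in simp)
  show "emb s1 s2 u * emb (- s1) s2 u \<in> quad_field (real q2)"
    unfolding *(5) emb_bq[OF *(1-4)] norm quad_field_def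
    by (rule CollectI, rule exI, rule exI, rule conjI, rule refl) (use * in simp)
  have "s1 * s2 = sqrt (real (q1 * q2))" by (simp add: real_sqrt_mult)
  thus "emb s1 (- s2) u * emb (- s1) s2 u \<in> quad_field (real (q1 * q2))"
    unfolding *(5) emb_bq[OF *(1-4)] norm quad_field_def
    by (simp only:) (rule CollectI, rule exI, rule exI, rule conjI, rule refl, use * in simp)
qed

lemma norm_unit:
  assumes xy: "(x, y) \<in> signs" "(x', y') \<in> signs"
    and L: "\<And>v. v \<in> K \<Longrightarrow> emb x y v * emb x' y' v \<in> L" and u: "u \<in> units_of_field K"
  shows "emb x y u * emb x' y' u \<in> units_of_field L"
proof -
  have int: "emb x y v * emb x' y' v \<in> ring_of_integers L" if "v \<in> units_of_field K" for v
    using that emb_unit(1)[OF xy(1) that] emb_unit(1)[OF xy(2) that] L[of v]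
    by (auto simp: ring_of_integers_def units_of_field_def algebraic_int_mult)
  have "inverse (emb x y u * emb x' y' u) = emb x y (inverse u) * emb x' y' (inverse u)"
    by (simp add: emb_unit(2)[OF xy(1) u] emb_unit(2)[OF xy(2) u])
  thus ?thesis
    using int[OF u] int[OF unit_inverse[OF u]] emb_unit(3)[OF xy(1) u] emb_unit(3)[OF xy(2) u]
    by (simp add: units_of_field_def)
qed

lemma roots_of_unity: "roots_of_unity_in K = {1, - 1}"
proof -
  have "- 1 \<in> roots_of_unity_in K"
    unfolding roots_of_unity_in_def using Rats_in_K[of "- 1"] by (auto intro!: exI[of _ 2])
  moreover have "1 \<in> roots_of_unity_in K"
    unfolding roots_of_unity_in_def using Rats_in_K[of 1] by auto
  ultimately show ?thesis
    by (auto simp: roots_of_unity_in_def dest: real_root_of_unity)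
qed

text \<open>A square root of an algebraic integer is one, and
  \<open>inverse h = h * inverse (h * h)\<close> covers the inverse.\<close>

lemma sqrt_unit:
  assumes "h \<in> K" "h * h \<in> units_of_field K"
  shows "h \<in> units_of_field K"
proof -
  have hh: "algebraic_int (h * h)" "h \<noteq> 0" "inverse (h * h) \<in> K" "algebraic_int (inverse (h * h))"
    using assms(2) by (auto simp: units_of_field_def ring_of_integers_def)
  have "algebraic_int (sqrt (h * h))" using hh(1) by blast
  hence h: "algebraic_int h" by simp
  have "inverse h = h * inverse (h * h)" using hh(2) by (simp add: field_simps)
  hence "inverse h \<in> K" "algebraic_int (inverse h)"
    using assms(1) hh h by (simp_all only: mult_closed algebraic_int_mult)
  thus ?thesis using assms(1) h hh(2) by (simp add: units_of_field_def ring_of_integers_def)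
qed

text \<open>Every conjugate of \<open>z\<close> is \<open>z\<close> or \<open>- z\<close>, which
  leaves a single nonzero coordinate. Then 2 would be a rational square times 1, \<open>q1\<close>,
  \<open>q2\<close> or \<open>q1 * q2\<close>.\<close>

lemma two_not_square:
  assumes "odd q1" "odd q2" "z \<in> K"
  shows "z * z \<noteq> 2"
proof
  assume z: "z * z = 2"
  obtain a b c e where *: "a \<in> \<rat>" "b \<in> \<rat>" "c \<in> \<rat>" "e \<in> \<rat>" "z = bq s1 s2 a b c e"
    using assms(3) by (rule K_cases)
  have conj: "emb x y z = z \<or> emb x y z = - z" if "(x, y) \<in> signs" for x y
  proof -
    have "emb x y z * emb x y z = z * z"
      using emb_mult[OF that assms(3,3)] emb_Rats[of 2 x y] z by simp
    thus ?thesis by (simp only: square_eq_iff)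
  qed
  have "emb (- s1) s2 z = bq s1 s2 a (- b) c (- e)" "emb s1 (- s2) z = bq s1 s2 a b (- c) (- e)"
    unfolding *(5) emb_bq[OF *(1-4)] by (simp_all add: bq_def)
  with conj[of "- s1" s2] conj[of s1 "- s2"]
  have "bq s1 s2 a (- b) c (- e) = bq s1 s2 a b c e \<or> bq s1 s2 a (- b) c (- e) = bq s1 s2 (- a) (- b) (- c) (- e)"
    "bq s1 s2 a b (- c) (- e) = bq s1 s2 a b c e \<or> bq s1 s2 a b (- c) (- e) = bq s1 s2 (- a) (- b) (- c) (- e)"
    by (auto simp: signs_def * bq_minus)
  hence cases: "(- b = b \<and> - e = e) \<or> (a = - a \<and> c = - c)" "(- c = c \<and> - e = e) \<or> (a = - a \<and> b = - b)"
    using * by (metis bq_inject Rats_minus_iff)+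
  have sf: "squarefree (1 :: nat)" "squarefree q1" "squarefree q2" "squarefree (q1 * q2)"
    using q1 q2 distinct by (auto simp: squarefree_prime primes_coprime intro: squarefree_mult_coprime)
  from cases consider "b = 0" "c = 0" "e = 0" | "a = 0" "c = 0" "e = 0"
    | "a = 0" "b = 0" "e = 0" | "a = 0" "b = 0" "c = 0" by fastforce
  hence "\<exists>w\<in>\<rat>. \<exists>m. squarefree m \<and> odd m \<and> w * w * real m = 2"
  proof cases
    case 1
    thus ?thesis using z * sf by (intro bexI[of _ a] exI[of _ 1]) (auto simp: bq_def)
  next
    case 2
    thus ?thesis using z * sf assms by (intro bexI[of _ b] exI[of _ q1]) (auto simp: bq_def mult_ac)
  next
    case 3
    thus ?thesis using z * sf assms by (intro bexI[of _ c] exI[of _ q2]) (auto simp: bq_def mult_ac)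
  next
    case 4
    have "z = e * (s1 * s2)" using 4 * by (simp add: bq_def)
    hence "z * z = e * e * (s1 * s1) * (s2 * s2)" by (simp only: mult_ac)
    hence "e * e * real (q1 * q2) = 2" using z by (simp add: mult_ac)
    thus ?thesis using * sf assms by (intro bexI[of _ e] exI[of _ "q1 * q2"]) auto
  qed
  thus False using two_not_rational_multiple_square by blast
qed

end

section \<open>The fundamental system of units\<close>

text \<open>Collects the explicit square roots; \<open>\<delta>1\<close>, \<open>\<delta>2\<close>
  and \<open>\<tau>\<close> are the signs of the three norm equations, from which all signatures are
  read off.\<close>

locale biquad_units = biquad +
  fixes \<epsilon>1 \<epsilon>2 \<epsilon>3 :: real and r1 t1 r2 t2 r3 t3 :: nat and \<delta>1 \<delta>2 \<tau> :: int
  assumes odd: "odd q1" "odd q2"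
    and fundamental: "is_fundamental_unit (real q1) \<epsilon>1" "is_fundamental_unit (real q2) \<epsilon>2"
      "is_fundamental_unit (real (q1 * q2)) \<epsilon>3"
    and coeff_pos: "r1 > 0" "t1 > 0" "r2 > 0" "t2 > 0"
    and \<epsilon>_eq: "\<epsilon>1 = (real r1 + real t1 * s1) ^ 2 / 2" "\<epsilon>2 = (real r2 + real t2 * s2) ^ 2 / 2"
      "\<epsilon>3 = ((real r3 * s1 + real t3 * s2) / 2) ^ 2"
    and \<delta>: "int r1 ^ 2 - int q1 * int t1 ^ 2 = 2 * \<delta>1" "int r2 ^ 2 - int q2 * int t2 ^ 2 = 2 * \<delta>2"
      "\<bar>\<delta>1\<bar> = 1" "\<bar>\<delta>2\<bar> = 1"
    and \<tau>: "int q1 * int r3 ^ 2 - int q2 * int t3 ^ 2 = 4 * \<tau>" "\<bar>\<tau>\<bar> = 1"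
begin

text \<open>\<open>\<eta>1\<close> and \<open>\<eta>2\<close> are the square roots of
  \<open>\<epsilon>1 * \<epsilon>2\<close> and \<open>\<epsilon>3\<close>, written so that
  conjugations can be applied.\<close>

definition "\<eta>1 = (real r1 + real t1 * s1) * (real r2 + real t2 * s2) / 2"
definition "\<eta>2 = (real r3 * s1 + real t3 * s2) / 2"

lemma gt_1: "\<epsilon>1 > 1" "\<epsilon>2 > 1" "\<epsilon>3 > 1"
  using fundamental by (auto simp: is_fundamental_unit_def)

lemma \<eta>_square: "\<eta>1 * \<eta>1 = \<epsilon>1 * \<epsilon>2" "\<eta>2 * \<eta>2 = \<epsilon>3"
  by (simp_all add: \<eta>1_def \<eta>2_def \<epsilon>_eq power2_eq_square)

lemma \<eta>_pos: "\<eta>1 > 0" "\<eta>2 > 0"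
proof -
  show "\<eta>1 > 0" unfolding \<eta>1_def using coeff_pos pos by (intro divide_pos_pos mult_pos_pos add_pos_pos) auto
  have "\<eta>2 \<ge> 0" by (simp add: \<eta>2_def)
  moreover have "\<eta>2 \<noteq> 0" using \<eta>_square(2) gt_1(3) by auto
  ultimately show "\<eta>2 > 0" by simp
qed

lemma sqrt_eq: "sqrt (\<epsilon>1 * \<epsilon>2) = \<eta>1" "sqrt \<epsilon>3 = \<eta>2"
  using \<eta>_pos by (simp_all flip: \<eta>_square)

lemma r_t_in_K:
  "real r1 + real t1 * s1 \<in> K" "real r2 + real t2 * s2 \<in> K" "real r3 * s1 + real t3 * s2 \<in> K"
  by (simp_all add: add_closed mult_closed Rats_in_K s_in_K)

lemma half_in_K: "x \<in> K \<Longrightarrow> x / 2 \<in> K"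
  using mult_closed[OF _ Rats_in_K[of "1 / 2"]] by auto

lemma \<eta>_in_K: "\<eta>1 \<in> K" "\<eta>2 \<in> K"
  unfolding \<eta>1_def \<eta>2_def by (intro half_in_K mult_closed r_t_in_K)+

lemma quad_subset_K:
  "quad_field (real q1) \<subseteq> K" "quad_field (real q2) \<subseteq> K" "quad_field (real (q1 * q2)) \<subseteq> K"
  by (auto simp: quad_field_def real_sqrt_mult add_closed mult_closed Rats_in_K s_in_K)

lemma \<epsilon>_unit: "\<epsilon>1 \<in> units_of_field K" "\<epsilon>2 \<in> units_of_field K" "\<epsilon>3 \<in> units_of_field K"
  using fundamental quad_subset_K[THEN units_of_field_mono] by (auto simp: is_fundamental_unit_def)

lemma \<eta>_unit: "\<eta>1 \<in> units_of_field K" "\<eta>2 \<in> units_of_field K"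
  using sqrt_unit[OF \<eta>_in_K(1)] sqrt_unit[OF \<eta>_in_K(2)] unit_mult[OF \<epsilon>_unit(1,2)] \<epsilon>_unit(3)
  by (simp_all only: \<eta>_square)

lemma
  assumes "(x, y) \<in> signs"
  shows emb_\<eta>1: "emb x y \<eta>1 = (real r1 + real t1 * x) * (real r2 + real t2 * y) / 2"
    and emb_\<eta>2: "emb x y \<eta>2 = (real r3 * x + real t3 * y) / 2"
    and emb_\<epsilon>1: "emb x y \<epsilon>1 = (real r1 + real t1 * x) ^ 2 / 2"
    and emb_\<epsilon>2: "emb x y \<epsilon>2 = (real r2 + real t2 * y) ^ 2 / 2"
    and emb_\<epsilon>3: "emb x y \<epsilon>3 = ((real r3 * x + real t3 * y) / 2) ^ 2"
proof -
  note rules = emb_add emb_mult[OF assms] emb_Rats emb_s Rats_in_K s_in_K add_closed mult_closed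
  have r1: "emb x y (real r1 + real t1 * s1) = real r1 + real t1 * x"
    and r2: "emb x y (real r2 + real t2 * s2) = real r2 + real t2 * y"
    and r3: "emb x y (real r3 * s1 + real t3 * s2) = real r3 * x + real t3 * y"
    by (simp_all add: rules)
  have half: "emb x y (z / 2) = emb x y z / 2" if "z \<in> K" for z
    using emb_mult[OF assms that Rats_in_K[of "1 / 2"]] emb_Rats[of "1 / 2" x y] by simp
  show "emb x y \<eta>1 = (real r1 + real t1 * x) * (real r2 + real t2 * y) / 2"
    unfolding \<eta>1_def by (simp only: half mult_closed r_t_in_K emb_mult[OF assms] r1 r2)
  show \<eta>2: "emb x y \<eta>2 = (real r3 * x + real t3 * y) / 2"
    unfolding \<eta>2_def by (simp only: half r_t_in_K r3)
  show "emb x y \<epsilon>1 = (real r1 + real t1 * x) ^ 2 / 2"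
    unfolding \<epsilon>_eq power2_eq_square by (simp only: half mult_closed r_t_in_K emb_mult[OF assms] r1)
  show "emb x y \<epsilon>2 = (real r2 + real t2 * y) ^ 2 / 2"
    unfolding \<epsilon>_eq power2_eq_square by (simp only: half mult_closed r_t_in_K emb_mult[OF assms] r2)
  show "emb x y \<epsilon>3 = ((real r3 * x + real t3 * y) / 2) ^ 2"
    unfolding \<eta>_square(2)[symmetric] power2_eq_square
    by (simp only: emb_mult[OF assms] \<eta>_in_K \<eta>2)
qed

lemma signs_mem: "(s1, s2) \<in> signs" "(- s1, s2) \<in> signs" "(s1, - s2) \<in> signs" "(- s1, - s2) \<in> signs"
  by (auto simp: signs_def)

lemma conjugate_products:
  "(real r1 + real t1 * s1) * (real r1 - real t1 * s1) = 2 * of_int \<delta>1"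
  "(real r2 + real t2 * s2) * (real r2 - real t2 * s2) = 2 * of_int \<delta>2"
  "(real r3 * s1 + real t3 * s2) * (real r3 * s1 - real t3 * s2) = 4 * of_int \<tau>"
  using arg_cong[OF \<delta>(1), of real_of_int] arg_cong[OF \<delta>(2), of real_of_int]
    arg_cong[OF \<tau>(1), of real_of_int]
  by (simp_all add: algebra_simps power2_eq_square)

text \<open>Each \<epsilon> has norm 1 in its own field, so a conjugation fixes it or inverts it,
  according to its effect on that field.\<close>

lemma emb_\<epsilon>_conj:
  "emb s1 (- s2) \<epsilon>1 = \<epsilon>1" "emb s1 (- s2) \<epsilon>2 = inverse \<epsilon>2" "emb s1 (- s2) \<epsilon>3 = inverse \<epsilon>3"
  "emb (- s1) s2 \<epsilon>1 = inverse \<epsilon>1" "emb (- s1) s2 \<epsilon>2 = \<epsilon>2" "emb (- s1) s2 \<epsilon>3 = inverse \<epsilon>3"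
proof -
  have sq: "(of_int \<delta>1 :: real) ^ 2 = 1" "(of_int \<delta>2 :: real) ^ 2 = 1" "(of_int \<tau> :: real) ^ 2 = 1"
    using \<delta>(3,4) \<tau>(2) by (auto simp: abs_if split: if_splits)
  have inv: "inverse (a ^ 2 / 2) = b ^ 2 / 2" if "a * b = 2 * d" "d ^ 2 = 1" for a b d :: real
  proof (rule inverse_unique)
    have "a ^ 2 / 2 * (b ^ 2 / 2) = (a * b) ^ 2 / 4" by (simp add: power_mult_distrib)
    thus "a ^ 2 / 2 * (b ^ 2 / 2) = 1" by (simp add: that power_mult_distrib)
  qed
  have inv': "inverse ((a / 2) ^ 2) = (b / 2) ^ 2" if "a * b = 4 * d" "d ^ 2 = 1" for a b d :: real
  proof (rule inverse_unique)
    have "(a / 2) ^ 2 * (b / 2) ^ 2 = (a * b) ^ 2 / 16" by (simp add: power_mult_distrib power_divide)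
    thus "(a / 2) ^ 2 * (b / 2) ^ 2 = 1" by (simp add: that power_mult_distrib)
  qed
  show "emb s1 (- s2) \<epsilon>1 = \<epsilon>1" "emb (- s1) s2 \<epsilon>2 = \<epsilon>2"
    unfolding emb_\<epsilon>1[OF signs_mem(3)] emb_\<epsilon>2[OF signs_mem(3)] emb_\<epsilon>1[OF signs_mem(2)] emb_\<epsilon>2[OF signs_mem(2)]
    by (simp_all add: \<epsilon>_eq)
  show "emb s1 (- s2) \<epsilon>2 = inverse \<epsilon>2" "emb (- s1) s2 \<epsilon>1 = inverse \<epsilon>1"
    using inv[OF conjugate_products(1) sq(1)] inv[OF conjugate_products(2) sq(2)]
    unfolding emb_\<epsilon>1[OF signs_mem(3)] emb_\<epsilon>2[OF signs_mem(3)] emb_\<epsilon>1[OF signs_mem(2)] emb_\<epsilon>2[OF signs_mem(2)]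
    by (simp_all add: \<epsilon>_eq)
  show "emb s1 (- s2) \<epsilon>3 = inverse \<epsilon>3"
    using inv'[OF conjugate_products(3) sq(3)] unfolding emb_\<epsilon>3[OF signs_mem(3)] by (simp add: \<epsilon>_eq)
  have "(real r3 * (- s1) + real t3 * s2) ^ 2 = (real r3 * s1 - real t3 * s2) ^ 2"
    by (simp add: power2_commute)
  thus "emb (- s1) s2 \<epsilon>3 = inverse \<epsilon>3"
    using inv'[OF conjugate_products(3) sq(3)] 
    unfolding emb_\<epsilon>3[OF signs_mem(2)] by (simp add: \<epsilon>_eq power_divide)
qed

text \<open>With \<open>N\<^sub>1\<close>, \<open>N\<^sub>2\<close> relative norms and \<open>N\<^sub>3\<close> a conjugate of one, \<open>u\<^sup>2 = N\<^sub>1 u * N\<^sub>2 u / N\<^sub>3 u\<close>.\<close>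

lemma unit_square:
  assumes u: "u \<in> units_of_field K"
  obtains a b c :: int where "u * u * \<epsilon>3 powi c = \<epsilon>1 powi a * \<epsilon>2 powi b"
proof -
  have "u \<in> K" using u by (simp add: units_of_field_def ring_of_integers_def)
  hence u1: "emb s1 s2 u = u" by (rule emb_id)
  let ?N1 = "emb s1 s2 u * emb s1 (- s2) u" and ?N2 = "emb s1 s2 u * emb (- s1) s2 u"
    and ?N3 = "emb s1 (- s2) u * emb (- s1) s2 u"
  obtain a where a: "?N1 = \<epsilon>1 powi a \<or> ?N1 = - (\<epsilon>1 powi a)"
    using fundamental_unit_generates[OF fundamental(1) norm_unit[OF _ _ norm_in_quad(1) u]] signs_mem by blast
  obtain b where b: "?N2 = \<epsilon>2 powi b \<or> ?N2 = - (\<epsilon>2 powi b)"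
    using fundamental_unit_generates[OF fundamental(2) norm_unit[OF _ _ norm_in_quad(2) u]] signs_mem by blast
  obtain c where c: "?N3 = \<epsilon>3 powi c \<or> ?N3 = - (\<epsilon>3 powi c)"
    using fundamental_unit_generates[OF fundamental(3) norm_unit[OF _ _ norm_in_quad(3) u]] signs_mem by blast
  have pp: "\<epsilon>1 powi a > 0" "\<epsilon>2 powi b > 0" "\<epsilon>3 powi c > 0" using gt_1 by simp_all
  \<comment> \<open>Absolute values remove the unknown signs, and \<open>u * u\<close> is
    positive.\<close>
  have abs: "\<bar>?N1\<bar> = \<epsilon>1 powi a" "\<bar>?N2\<bar> = \<epsilon>2 powi b" "\<bar>?N3\<bar> = \<epsilon>3 powi c"
    using a b c pp by (auto simp only: abs_minus_cancel abs_of_pos)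
  have "u * u * ?N3 = ?N1 * ?N2" by (simp add: u1)
  hence "\<bar>u * u\<bar> * \<bar>?N3\<bar> = \<bar>?N1\<bar> * \<bar>?N2\<bar>" by (simp only: abs_mult)
  hence "u * u * \<epsilon>3 powi c = \<epsilon>1 powi a * \<epsilon>2 powi b" unfolding abs by simp
  thus ?thesis using that by blast
qed

text \<open>Twice \<open>\<epsilon>2\<close> is a square in \<open>K\<close>, so a square root of
  \<open>\<epsilon>2\<close> would produce one of 2.\<close>

lemma \<epsilon>2_not_square: "v \<in> units_of_field K \<Longrightarrow> v * v \<noteq> \<epsilon>2"
proof
  assume v: "v \<in> units_of_field K" and eq: "v * v = \<epsilon>2"
  have "inverse v \<in> K" "v \<noteq> 0" using v by (auto simp: units_of_field_def ring_of_integers_def)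
  define g where "g = (real r2 + real t2 * s2) * inverse v"
  have "g \<in> K" unfolding g_def by (intro mult_closed r_t_in_K \<open>inverse v \<in> K\<close>)
  have "g * g = (real r2 + real t2 * s2) ^ 2 * inverse (v * v)"
    by (simp add: g_def power2_eq_square)
  also have "\<dots> = 2 * \<epsilon>2 * inverse \<epsilon>2" unfolding eq by (simp add: \<epsilon>_eq)
  also have "\<dots> = 2" using gt_1 by simp
  finally show False using two_not_square[OF odd \<open>g \<in> K\<close>] by blast
qed

lemma unit_generation:
  assumes u: "u \<in> units_of_field K"
  obtains z a b c where "z \<in> {1, - 1}" "u = z * (\<eta>1 powi a * (\<eta>2 powi b * \<epsilon>2 powi c))"
proof -
  obtain a b c where abc: "u * u * \<epsilon>3 powi c = \<epsilon>1 powi a * \<epsilon>2 powi b"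
    by (rule unit_square[OF u])
  have pp: "\<epsilon>1 \<noteq> 0" "\<epsilon>2 \<noteq> 0" "\<epsilon>3 \<noteq> 0" "\<eta>1 \<noteq> 0" "\<eta>2 \<noteq> 0" using gt_1 \<eta>_pos by simp_all
  \<comment> \<open>The exponents are chosen so that the powers of \<open>\<epsilon>1\<close> and
    \<open>\<epsilon>3\<close> cancel in \<open>w * w\<close>.\<close>
  define w where "w = u * \<eta>1 powi (- a) * \<eta>2 powi c"
  have w_unit: "w \<in> units_of_field K"
    unfolding w_def by (intro unit_mult unit_powi u \<eta>_unit)
  have "w * w = (u * u * (\<eta>2 * \<eta>2) powi c) * (\<eta>1 * \<eta>1) powi (- a)"
    unfolding w_def power_int_mult_distrib by (simp only: mult_ac)
  also have "\<dots> = \<epsilon>1 powi a * \<epsilon>2 powi b * (\<epsilon>1 * \<epsilon>2) powi (- a)"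
    unfolding \<eta>_square abc ..
  also have "\<dots> = (\<epsilon>1 powi a * \<epsilon>1 powi (- a)) * (\<epsilon>2 powi b * \<epsilon>2 powi (- a))"
    unfolding power_int_mult_distrib by (simp only: mult_ac)
  also have "\<dots> = \<epsilon>2 powi (b - a)"
    using pp by (simp flip: power_int_add)
  finally have ww: "w * w = \<epsilon>2 powi (b - a)" .
  \<comment> \<open>Removing the rounded-down half of the exponent leaves \<open>v * v\<close> equal
    to 1 or to \<open>\<epsilon>2\<close>; the latter is excluded.\<close>
  define k where "k = (b - a) div 2"
  define v where "v = w * \<epsilon>2 powi (- k)"
  have v_unit: "v \<in> units_of_field K"
    unfolding v_def by (intro unit_mult unit_powi w_unit \<epsilon>_unit)
  have "v * v = (w * w) * (\<epsilon>2 powi (- k) * \<epsilon>2 powi (- k))"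
    unfolding v_def by (simp only: mult_ac)
  also have "\<dots> = \<epsilon>2 powi (b - a - 2 * k)"
    unfolding ww using pp by (simp flip: power_int_add)
  also have "b - a - 2 * k = (b - a) mod 2"
    by (simp add: k_def minus_mult_div_eq_mod)
  finally have vv: "v * v = \<epsilon>2 powi ((b - a) mod 2)" .
  have "(b - a) mod 2 \<noteq> 1"
  proof
    assume "(b - a) mod 2 = 1"
    thus False using vv \<epsilon>2_not_square[OF v_unit] by simp
  qed
  hence "(b - a) mod 2 = 0" by presburger
  hence "v * v = 1 * 1" using vv by simp
  hence "v \<in> {1, - 1}" by (simp only: square_eq_iff) simp
  moreover have "u = v * (\<eta>1 powi a * (\<eta>2 powi (- c) * \<epsilon>2 powi k))"
    using pp by (simp add: v_def w_def power_int_minus field_simps)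
  ultimately show ?thesis using that by blast
qed

text \<open>Squaring turns the relation into one among \<open>\<epsilon>1\<close>,
  \<open>\<epsilon>2\<close>, \<open>\<epsilon>3\<close> with exponents \<open>a\<close>,
  \<open>a + 2 * c\<close>, \<open>b\<close>, where conjugations act by inverting factors.\<close>

lemma unit_independence:
  assumes z: "z \<in> {1, - 1}" and eq: "z * (\<eta>1 powi a * (\<eta>2 powi b * \<epsilon>2 powi c)) = 1"
  shows "a = 0 \<and> b = 0 \<and> c = 0"
proof -
  have pp: "\<epsilon>1 > 0" "\<epsilon>2 > 0" "\<epsilon>3 > 0" using gt_1 by simp_all
  have "z * z = 1" using z by auto
  have "(\<eta>1 * \<eta>1) powi a * ((\<eta>2 * \<eta>2) powi b * (\<epsilon>2 powi c * \<epsilon>2 powi c)) =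
      (z * z) * (\<eta>1 powi a * (\<eta>2 powi b * \<epsilon>2 powi c)) * (\<eta>1 powi a * (\<eta>2 powi b * \<epsilon>2 powi c))"
    unfolding \<open>z * z = 1\<close> power_int_mult_distrib by (simp only: mult_ac mult_1_left)
  also have "\<dots> = (z * (\<eta>1 powi a * (\<eta>2 powi b * \<epsilon>2 powi c))) * (z * (\<eta>1 powi a * (\<eta>2 powi b * \<epsilon>2 powi c)))"
    by (simp only: mult_ac)
  also have "\<dots> = 1" unfolding eq by simp
  finally have "\<epsilon>1 powi a * \<epsilon>2 powi (a + 2 * c) * \<epsilon>3 powi b = 1"
    unfolding \<eta>_square power_int_mult_distrib
    using pp by (simp add: power_int_add power_int_mult mult_ac power2_eq_square)
  moreover define P1 P2 P3 where "P1 = \<epsilon>1 powi a" and "P2 = \<epsilon>2 powi (a + 2 * c)" and "P3 = \<epsilon>3 powi b"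
  ultimately have P: "P1 * P2 * P3 = 1" by simp
  have unit: "P1 \<in> units_of_field K" "P2 \<in> units_of_field K" "P3 \<in> units_of_field K"
    unfolding P1_def P2_def P3_def by (intro unit_powi \<epsilon>_unit)+
  hence mem: "P1 \<in> K" "P2 \<in> K" "P3 \<in> K" by (auto simp: units_of_field_def ring_of_integers_def)
  have Ppos: "P1 > 0" "P2 > 0" "P3 > 0" unfolding P1_def P2_def P3_def using pp by simp_all
  have emb_P: "emb x y P1 * emb x y P2 * emb x y P3 = 1" if "(x, y) \<in> signs" for x y
    using arg_cong[OF P, of "emb x y"] emb_Rats[of 1 x y] emb_mult[OF that] mem mult_closed by simp
  \<comment> \<open>This conjugation fixes \<open>P1\<close> and inverts the other two, so
    multiplying by the original relation isolates \<open>P1 * P1\<close>.\<close>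
  have "P1 * inverse P2 * inverse P3 = 1"
    using emb_P[OF signs_mem(3)] unfolding P1_def P2_def P3_def
    by (simp add: emb_powi[OF signs_mem(3)] \<epsilon>_unit emb_\<epsilon>_conj power_int_inverse)
  hence "P1 * P1 = 1" using P Ppos by (simp add: field_simps)
  hence "P1 = 1 \<or> P1 = - 1" by (simp only: square_eq_1_iff)
  hence P1: "P1 = 1" using Ppos by linarith
  hence a: "a = 0" using real_powi_eq_1[OF gt_1(1)] by (simp add: P1_def)
  have "inverse P1 * P2 * inverse P3 = 1"
    using emb_P[OF signs_mem(2)] unfolding P1_def P2_def P3_def
    by (simp add: emb_powi[OF signs_mem(2)] \<epsilon>_unit emb_\<epsilon>_conj power_int_inverse)
  hence "P2 * P2 = 1" using P P1 Ppos by (simp add: field_simps)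
  hence "P2 = 1 \<or> P2 = - 1" by (simp only: square_eq_1_iff)
  hence P2: "P2 = 1" using Ppos by linarith
  hence "a + 2 * c = 0" using real_powi_eq_1[OF gt_1(2)] by (simp add: P2_def)
  moreover have "P3 = 1" using P P1 P2 by simp
  hence "b = 0" using real_powi_eq_1[OF gt_1(3)] by (simp add: P3_def)
  ultimately show ?thesis using a by simp
qed

lemma fundamental_system: "is_fundamental_system K [\<eta>1, \<eta>2, \<epsilon>2]"
  unfolding is_fundamental_system_def
proof (intro conjI ballI)
  show "set [\<eta>1, \<eta>2, \<epsilon>2] \<subseteq> units_of_field K" using \<eta>_unit \<epsilon>_unit by simp
next
  fix u assume u: "u \<in> units_of_field K"
  have pp: "\<eta>1 \<noteq> 0" "\<eta>2 \<noteq> 0" "\<epsilon>2 \<noteq> 0" using gt_1 \<eta>_pos by simp_all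
  obtain z a b c where abc: "z \<in> {1, - 1}" "u = z * (\<eta>1 powi a * (\<eta>2 powi b * \<epsilon>2 powi c))"
    by (rule unit_generation[OF u])
  show "\<exists>!(z, ks). z \<in> roots_of_unity_in K \<and> length ks = length [\<eta>1, \<eta>2, \<epsilon>2] \<and>
          u = z * prod_list (map2 (\<lambda>e k. e powi k) [\<eta>1, \<eta>2, \<epsilon>2] ks)"
    unfolding roots_of_unity
  proof (rule ex1I[of _ "(z, [a, b, c])"])
    show "case (z, [a, b, c]) of (z, ks) \<Rightarrow> z \<in> {1, - 1} \<and> length ks = length [\<eta>1, \<eta>2, \<epsilon>2] \<and>
          u = z * prod_list (map2 (\<lambda>e k. e powi k) [\<eta>1, \<eta>2, \<epsilon>2] ks)"
      using abc by simp
  next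
    fix p assume "case p of (z, ks) \<Rightarrow> z \<in> {1, - 1} \<and> length ks = length [\<eta>1, \<eta>2, \<epsilon>2] \<and>
          u = z * prod_list (map2 (\<lambda>e k. e powi k) [\<eta>1, \<eta>2, \<epsilon>2] ks)"
    then obtain z' ks where p: "p = (z', ks)" "z' \<in> {1, - 1}" "length ks = 3"
        "u = z' * prod_list (map2 (\<lambda>e k. e powi k) [\<eta>1, \<eta>2, \<epsilon>2] ks)"
      by (cases p) auto
    obtain a' b' c' where ks: "ks = [a', b', c']"
      using p(3) by (auto simp: length_Suc_conv eval_nat_numeral)
    have u': "u = z' * (\<eta>1 powi a' * (\<eta>2 powi b' * \<epsilon>2 powi c'))"
      using p(4) by (simp add: ks)
    have zz: "z * z' \<in> {1, - 1}" "z' * z' = 1" using abc(1) p(2) by auto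
    \<comment> \<open>The quotient of two representations of \<open>u\<close> is a relation of the
      kind settled by \<open>unit_independence\<close>.\<close>
    have "(z * z') * (\<eta>1 powi (a - a') * (\<eta>2 powi (b - b') * \<epsilon>2 powi (c - c'))) = u / u * (z' * z')"
      using pp abc(1) p(2) by (subst (1) abc(2), subst u') (auto simp: power_int_diff)
    also have "\<dots> = 1" using u zz by (simp add: units_of_field_def)
    finally have "a - a' = 0 \<and> b - b' = 0 \<and> c - c' = 0" by (rule unit_independence[OF zz(1)])
    hence "a = a'" "b = b'" "c = c'" by simp_all
    moreover from this have "z = z'" using abc(2) u' pp by simp
    ultimately show "p = (z, [a, b, c])" by (simp add: p ks)
  qed
qed

end

section \<open>Unit signatures\<close>

lemma not_prime_3mod4_dvd_4:
  assumes "prime p" "p mod 4 = 3"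
  shows "\<not> int p dvd 2" "\<not> int p dvd 4"
proof -
  show 2: "\<not> int p dvd 2"
    using assms prime_gt_1_nat[of p] by (auto dest!: zdvd_imp_le)
  show "\<not> int p dvd 4"
  proof
    assume "int p dvd 4"
    hence "int p dvd 2 * 2" by simp
    moreover have "prime (int p)" using assms(1) by simp
    ultimately show False using 2 prime_dvd_mult_iff by blast
  qed
qed

text \<open>Modulo \<open>q\<close> the equation says \<open>p * r ^ 2 = 4 * \<tau>\<close>. For
  \<open>\<tau> = 1\<close> this makes \<open>p\<close> a square; for \<open>\<tau> = - 1\<close> a
  square \<open>p\<close> would let \<open>q\<close> divide a sum of two squares. The negated
  conclusions are used by contraposition.\<close>

lemma Legendre_from_norm_equation:
  fixes p q :: nat and r s \<tau> :: int
  assumes q: "prime q" "q mod 4 = 3" and eq: "int p * r ^ 2 - int q * s ^ 2 = 4 * \<tau>"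
  shows "\<tau> = 1 \<Longrightarrow> Legendre (int p) (int q) \<noteq> - 1" and "\<tau> = - 1 \<Longrightarrow> Legendre (int p) (int q) \<noteq> 1"
proof -
  have cong: "[int p * r ^ 2 = 4 * \<tau>] (mod int q)"
    unfolding eq[symmetric] by (simp add: cong_iff_dvd_diff)
  have pq: "prime (int q)" using q(1) by simp
  show "Legendre (int p) (int q) \<noteq> - 1" if "\<tau> = 1"
  proof -
    have cong': "[int p * r ^ 2 = 4] (mod int q)" using cong that by simp
    have "\<not> int q dvd r"
    proof
      assume "int q dvd r"
      hence "int q dvd int p * r ^ 2" by (simp add: power2_eq_square)
      hence "int q dvd 4" using cong' cong_dvd_iff by blast
      thus False using not_prime_3mod4_dvd_4[OF q] by simp
    qed
    hence "coprime r (int q)"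
      using prime_imp_coprime[OF pq] by (simp add: coprime_commute)
    then obtain x where x: "[r * x = 1] (mod int q)"
      using cong_solve_coprime_int by blast
    \<comment> \<open>As \<open>x\<close> inverts \<open>r\<close>, the square root of
      \<open>p\<close> modulo \<open>q\<close> is 2 divided by \<open>r\<close>.\<close>
    have "[(2 * x) ^ 2 = 4 * x ^ 2] (mod int q)" by (simp add: power_mult_distrib)
    also have "[4 * x ^ 2 = int p * r ^ 2 * x ^ 2] (mod int q)"
      by (intro cong_mult cong_refl) (rule cong_sym[OF cong'])
    also have "int p * r ^ 2 * x ^ 2 = int p * (r * x) ^ 2"
      by (simp add: power_mult_distrib)
    also have "[int p * (r * x) ^ 2 = int p * 1 ^ 2] (mod int q)"
      by (intro cong_mult cong_refl cong_pow x)
    finally have "QuadRes (int q) (int p)" 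
      unfolding QuadRes_def by (intro exI[of _ "2 * x"]) (simp only: power_one mult_1_right)
    thus ?thesis by (simp add: Legendre_def)
  qed
  show "Legendre (int p) (int q) \<noteq> 1" if "\<tau> = - 1"
  proof
    assume "Legendre (int p) (int q) = 1"
    hence "QuadRes (int q) (int p)" by (auto simp: Legendre_def split: if_splits)
    then obtain y where y: "[y ^ 2 = int p] (mod int q)" by (auto simp: QuadRes_def)
    have "[(y * r) ^ 2 = int p * r ^ 2] (mod int q)"
      unfolding power_mult_distrib by (intro cong_mult y cong_refl)
    also have "[int p * r ^ 2 = - 4] (mod int q)" using cong that by simp
    finally have "int q dvd (y * r) ^ 2 + 2 ^ 2" by (simp add: cong_iff_dvd_diff)
    hence "int q dvd 2" by (rule prime_3mod4_dvd_sum_squares[OF q])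
    thus False using not_prime_3mod4_dvd_4[OF q] by simp
  qed
qed

context biquad_units
begin

lemma signature_emb: "(x, y) \<in> signs \<Longrightarrow> signature K u (emb x y) = neg_bit (emb x y u)"
  unfolding signature_def neg_bit_def real_embeddings_eq by force

lemma neg_bit_half: "neg_bit (x / 2) = neg_bit x"
  by (simp add: neg_bit_def)

lemma neg_bit_minus: "x \<noteq> 0 \<Longrightarrow> neg_bit (- x) = 1 + neg_bit x"
  by (auto simp: neg_bit_def)

lemma neg_bit_pos: "x > 0 \<Longrightarrow> neg_bit x = 0"
  by (simp add: neg_bit_def)

text \<open>Each difference times the corresponding positive sum is a positive constant times
  \<delta>1, \<delta>2 or \<tau>, so it has that sign.\<close>

lemma neg_bit_conjugates:
  "neg_bit (real r1 + real t1 * s1) = 0" "neg_bit (real r2 + real t2 * s2) = 0"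
  "neg_bit (real r3 * s1 + real t3 * s2) = 0"
  "neg_bit (real r1 - real t1 * s1) = neg_bit (of_int \<delta>1)"
  "neg_bit (real r2 - real t2 * s2) = neg_bit (of_int \<delta>2)"
  "neg_bit (real r3 * s1 - real t3 * s2) = neg_bit (of_int \<tau>)"
  and conjugates_nonzero:
  "real r1 + real t1 * s1 \<noteq> 0" "real r2 + real t2 * s2 \<noteq> 0" "real r3 * s1 + real t3 * s2 \<noteq> 0"
  "real r1 - real t1 * s1 \<noteq> 0" "real r2 - real t2 * s2 \<noteq> 0" "real r3 * s1 - real t3 * s2 \<noteq> 0"
proof -
  have gr: "real r1 + real t1 * s1 > 0" "real r2 + real t2 * s2 > 0" "real r3 * s1 + real t3 * s2 > 0"
    using coeff_pos pos \<eta>_pos(2) unfolding \<eta>2_def by (auto intro!: add_pos_pos)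
  have *: "b \<noteq> 0 \<and> neg_bit b = neg_bit (of_int d)" if "a > 0" "a * b = k * of_int d" "\<bar>d\<bar> = 1" "k > 0"
    for a b k :: real and d :: int
  proof -
    have "d = 1 \<or> d = - 1" using that(3) by linarith
    hence "a * b = k \<or> a * b = - k" using that(2) by auto
    moreover have "b > 0" if "a * b = k"
      using that \<open>a > 0\<close> \<open>k > 0\<close> by (metis zero_less_mult_pos)
    moreover have "b < 0" if "a * b = - k"
      using that \<open>a > 0\<close> \<open>k > 0\<close> by (metis mult_less_0_iff neg_less_0_iff_less not_less_iff_gr_or_eq)
    ultimately show ?thesis
      using \<open>d = 1 \<or> d = - 1\<close> that(2,4) by (auto simp: neg_bit_def)
  qed
  show "real r1 + real t1 * s1 \<noteq> 0" "real r2 + real t2 * s2 \<noteq> 0" "real r3 * s1 + real t3 * s2 \<noteq> 0"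
    using gr by linarith+
  show "neg_bit (real r1 + real t1 * s1) = 0" "neg_bit (real r2 + real t2 * s2) = 0"
    "neg_bit (real r3 * s1 + real t3 * s2) = 0"
    using gr by (simp_all only: neg_bit_pos)
  show "neg_bit (real r1 - real t1 * s1) = neg_bit (of_int \<delta>1)" "real r1 - real t1 * s1 \<noteq> 0"
    using *[OF gr(1) conjugate_products(1) \<delta>(3)] by simp_all
  show "neg_bit (real r2 - real t2 * s2) = neg_bit (of_int \<delta>2)" "real r2 - real t2 * s2 \<noteq> 0"
    using *[OF gr(2) conjugate_products(2) \<delta>(4)] by simp_all
  show "neg_bit (real r3 * s1 - real t3 * s2) = neg_bit (of_int \<tau>)" "real r3 * s1 - real t3 * s2 \<noteq> 0"
    using *[OF gr(3) conjugate_products(3) \<tau>(2)] by simp_all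
qed

lemma signature_minus_1: "\<sigma> \<in> real_embeddings K \<Longrightarrow> signature K (- 1) \<sigma> = 1"
  by (auto simp: real_embeddings_eq signature_emb emb_Rats neg_bit_def)

lemma signature_\<eta>1:
  "signature K \<eta>1 (emb s1 s2) = 0" "signature K \<eta>1 (emb (- s1) s2) = neg_bit (of_int \<delta>1)"
  "signature K \<eta>1 (emb s1 (- s2)) = neg_bit (of_int \<delta>2)"
  "signature K \<eta>1 (emb (- s1) (- s2)) = neg_bit (of_int \<delta>1) + neg_bit (of_int \<delta>2)"
  using conjugates_nonzero
  by (simp_all add: signature_emb signs_mem emb_\<eta>1 neg_bit_half neg_bit_mult neg_bit_conjugates)

lemma signature_\<eta>2:
  "signature K \<eta>2 (emb s1 s2) = 0" "signature K \<eta>2 (emb (- s1) s2) = 1 + neg_bit (of_int \<tau>)"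
  "signature K \<eta>2 (emb s1 (- s2)) = neg_bit (of_int \<tau>)"
  "signature K \<eta>2 (emb (- s1) (- s2)) = 1"
proof -
  have "real r3 * - s1 + real t3 * s2 = - (real r3 * s1 - real t3 * s2)"
    "real r3 * - s1 + real t3 * - s2 = - (real r3 * s1 + real t3 * s2)"
    "real r3 * s1 + real t3 * - s2 = real r3 * s1 - real t3 * s2" by simp_all
  note rw = this
  show "signature K \<eta>2 (emb s1 s2) = 0" "signature K \<eta>2 (emb (- s1) s2) = 1 + neg_bit (of_int \<tau>)"
    "signature K \<eta>2 (emb s1 (- s2)) = neg_bit (of_int \<tau>)"
    "signature K \<eta>2 (emb (- s1) (- s2)) = 1"
    using conjugates_nonzero
    by (simp_all only: signature_emb signs_mem emb_\<eta>2 neg_bit_half rw neg_bit_minus neg_bit_conjugates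
      not_False_eq_True add_0_right)
qed

text \<open>Signatures turn products into sums, and \<open>\<epsilon>2\<close> contributes nothing
  because its conjugates are halves of squares.\<close>

lemma signature_unit:
  assumes "u \<in> units_of_field K"
  obtains k0 k1 k2 :: bit where
    "\<And>\<sigma>. \<sigma> \<in> real_embeddings K \<Longrightarrow>
      signature K u \<sigma> = k0 * signature K (- 1) \<sigma> + k1 * signature K \<eta>1 \<sigma> + k2 * signature K \<eta>2 \<sigma>"
proof -
  obtain z a b c where abc: "z \<in> {1, - 1}" "u = z * (\<eta>1 powi a * (\<eta>2 powi b * \<epsilon>2 powi c))"
    by (rule unit_generation[OF assms])
  have "signature K u \<sigma> = neg_bit z * signature K (- 1) \<sigma> + of_int a * signature K \<eta>1 \<sigma> + of_int b * signature K \<eta>2 \<sigma>"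
    if \<sigma>: "\<sigma> \<in> real_embeddings K" for \<sigma>
  proof -
    obtain x y where xy: "(x, y) \<in> signs" "\<sigma> = emb x y"
      using \<sigma> by (auto simp: real_embeddings_eq)
    note units = \<eta>_unit \<epsilon>_unit
    have mem: "v powi k \<in> K" if "v \<in> units_of_field K" for v k
      using unit_powi[OF that, of k] by (simp add: units_of_field_def ring_of_integers_def)
    have "z \<in> K" using abc(1) Rats_in_K[of z] by auto
    have zz: "emb x y z = z" "z \<noteq> 0" using abc(1) by (auto simp: emb_Rats)
    have "emb x y u = z * (emb x y \<eta>1 powi a * (emb x y \<eta>2 powi b * emb x y \<epsilon>2 powi c))"
      unfolding abc(2)
      by (simp only: emb_mult[OF xy(1)] mem units mult_closed \<open>z \<in> K\<close> zz emb_powi[OF xy(1)])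
    moreover have nz: "emb x y \<eta>1 \<noteq> 0" "emb x y \<eta>2 \<noteq> 0" "emb x y \<epsilon>2 \<noteq> 0"
      using emb_unit(3)[OF xy(1)] units by blast+
    moreover have "neg_bit (emb x y \<epsilon>2) = 0"
      by (simp add: emb_\<epsilon>2[OF xy(1)] neg_bit_def not_less)
    ultimately have "neg_bit (emb x y u) = neg_bit z + (of_int a * neg_bit (emb x y \<eta>1) + of_int b * neg_bit (emb x y \<eta>2))"
      using zz(2) by (simp add: neg_bit_mult neg_bit_powi)
    thus ?thesis
      using signature_minus_1[OF \<sigma>] unfolding xy(2) signature_emb[OF xy(1)]
      by (simp only: mult_1_right add.assoc)
  qed
  thus ?thesis by (rule that)
qed

section \<open>Rank of the three sign vectors\<close>

lemma ball_real_embeddings: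
  "(\<forall>\<sigma>\<in>real_embeddings K. P \<sigma>) \<longleftrightarrow>
    P (emb s1 s2) \<and> P (emb (- s1) s2) \<and> P (emb s1 (- s2)) \<and> P (emb (- s1) (- s2))"
  by (auto simp: real_embeddings_eq signs_def)

lemma emb_in_real_embeddings: "(x, y) \<in> signs \<Longrightarrow> emb x y \<in> real_embeddings K"
  unfolding real_embeddings_eq by force

lemma minus_1_unit: "- 1 \<in> units_of_field K"
  by (rule unit_minus[OF unit_one])

lemma sum_lessThan_3: "(\<Sum>i<3. f i) = f 0 + f 1 + f (2 :: nat)" for f :: "nat \<Rightarrow> bit"
  by (simp only: numeral_3_eq_3 numeral_2_eq_2 One_nat_def sum.lessThan_Suc lessThan_0 sum.empty add_0_left)

lemma sum_lessThan_2: "(\<Sum>i<2. f i) = f 0 + f (1 :: nat)" for f :: "nat \<Rightarrow> bit"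
  by (simp only: numeral_2_eq_2 One_nat_def sum.lessThan_Suc lessThan_0 sum.empty add_0_left)

text \<open>The identity embedding forces \<open>c 0 = 0\<close>. The remaining system for
  \<open>c 1\<close> and \<open>c 2\<close> is nonsingular because \<open>\<delta>2 = - 1\<close>
  and either \<open>\<delta>1 = - 1\<close> or \<open>\<tau> = 1\<close>.\<close>

lemma unit_signature_rank_3:
  assumes "\<delta>2 = - 1" "\<delta>1 = - 1 \<or> \<tau> = 1"
  shows "unit_signature_rank K = 3"
  unfolding unit_signature_rank_def
proof (rule f2_dim_eqI)
  define g where "g = (\<lambda>i :: nat. signature K (if i = 0 then - 1 else if i = 1 then \<eta>1 else \<eta>2))"
  have g: "g 0 = signature K (- 1)" "g 1 = signature K \<eta>1" "g 2 = signature K \<eta>2"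
    by (simp_all add: g_def)
  show "g i \<in> signature K ` units_of_field K" if "i < 3" for i
    unfolding g_def using minus_1_unit \<eta>_unit by auto
  show "f2_independent (real_embeddings K) 3 g"
    unfolding f2_independent_def sum_lessThan_3 g
  proof (intro allI impI)
    fix c :: "nat \<Rightarrow> bit" and i :: nat
    assume "\<forall>\<sigma>\<in>real_embeddings K. c 0 * signature K (- 1) \<sigma> + c 1 * signature K \<eta>1 \<sigma> + c 2 * signature K \<eta>2 \<sigma> = 0"
      and i: "i < 3"
    hence "c 0 = 0" "c 0 + c 1 * neg_bit (of_int \<delta>1) + c 2 * (1 + neg_bit (of_int \<tau>)) = 0"
      "c 0 + c 1 * neg_bit (of_int \<delta>2) + c 2 * neg_bit (of_int \<tau>) = 0"
      "c 0 + c 1 * (neg_bit (of_int \<delta>1) + neg_bit (of_int \<delta>2)) + c 2 = 0"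
      unfolding ball_real_embeddings signature_\<eta>1 signature_\<eta>2 signs_mem[THEN emb_in_real_embeddings, THEN signature_minus_1]
        mult_1_right mult_zero_right add_0_right
      by blast+
    moreover have "neg_bit (of_int \<delta>2) = 1" using assms by (simp add: neg_bit_def)
    moreover have "neg_bit (of_int \<delta>1) = 1 \<or> neg_bit (of_int \<tau>) = 0" using assms by (auto simp: neg_bit_def)
    ultimately have "c 0 = 0 \<and> c 1 = 0 \<and> c 2 = 0"
      by (cases "c 1"; cases "c 2"; cases "neg_bit (of_int \<delta>1)"; cases "neg_bit (of_int \<tau>)") auto
    moreover have "i = 0 \<or> i = 1 \<or> i = 2" using i by auto
    ultimately show "c i = 0" by auto
  qed
  show "\<exists>c. \<forall>\<sigma>\<in>real_embeddings K. s \<sigma> = (\<Sum>j<3. c j * g j \<sigma>)" if s: "s \<in> signature K ` units_of_field K" for s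
  proof -
    obtain u where u: "u \<in> units_of_field K" "s = signature K u" using s by auto
    obtain k0 k1 k2 where "\<And>\<sigma>. \<sigma> \<in> real_embeddings K \<Longrightarrow>
      signature K u \<sigma> = k0 * signature K (- 1) \<sigma> + k1 * signature K \<eta>1 \<sigma> + k2 * signature K \<eta>2 \<sigma>"
      using signature_unit[OF u(1)] by blast
    thus ?thesis
      unfolding sum_lessThan_3 g u(2)
      by (intro exI[of _ "\<lambda>i. if i = 0 then k0 else if i = 1 then k1 else k2"]) simp
  qed
qed

text \<open>The signature of \<open>\<eta>1\<close> becomes a multiple of that of
  \<open>\<eta>2\<close>, so \<open>-1\<close> and \<open>\<eta>2\<close> already span; these two
  are independent for either sign \<tau>.\<close>

lemma unit_signature_rank_2:
  assumes "\<delta>1 = 1" "\<delta>2 = 1 \<or> \<tau> = - 1"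
  shows "unit_signature_rank K = 2"
  unfolding unit_signature_rank_def
proof (rule f2_dim_eqI)
  define g where "g = (\<lambda>i :: nat. signature K (if i = 0 then - 1 else \<eta>2))"
  have g: "g 0 = signature K (- 1)" "g 1 = signature K \<eta>2"
    by (simp_all add: g_def)
  show "g i \<in> signature K ` units_of_field K" if "i < 2" for i
    unfolding g_def using minus_1_unit \<eta>_unit by auto
  show "f2_independent (real_embeddings K) 2 g"
    unfolding f2_independent_def sum_lessThan_2 g
  proof (intro allI impI)
    fix c :: "nat \<Rightarrow> bit" and i :: nat
    assume "\<forall>\<sigma>\<in>real_embeddings K. c 0 * signature K (- 1) \<sigma> + c 1 * signature K \<eta>2 \<sigma> = 0"
      and i: "i < 2"
    hence "c 0 = 0" "c 0 + c 1 = 0"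
      unfolding ball_real_embeddings signature_\<eta>2 signs_mem[THEN emb_in_real_embeddings, THEN signature_minus_1]
        mult_1_right mult_zero_right add_0_right
      by blast+
    moreover have "i = 0 \<or> i = 1" using i by auto
    ultimately show "c i = 0" by auto
  qed
  have "neg_bit (of_int \<delta>1) = 0" "neg_bit (of_int \<delta>2) = 0 \<or> neg_bit (of_int \<tau>) = 1"
    using assms by (auto simp: neg_bit_def)
  \<comment> \<open>With \<open>\<delta>1 = 1\<close> the vector of \<open>\<eta>1\<close> is (0, 0,
    d, d), where d is the sign bit of \<open>\<delta>2\<close>. Either d is 0, or
    \<open>\<tau> = - 1\<close> and \<open>\<eta>2\<close> has vector (0, 0, 1, 1); hence the
    multiplier d.\<close>
  hence "\<exists>k. \<forall>\<sigma>\<in>real_embeddings K. signature K \<eta>1 \<sigma> = k * signature K \<eta>2 \<sigma>"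
    unfolding ball_real_embeddings signature_\<eta>1 signature_\<eta>2
    by (intro exI[of _ "neg_bit (of_int \<delta>2)"])
       (cases "neg_bit (of_int \<delta>2)"; cases "neg_bit (of_int \<tau>)"; auto)
  then obtain k where k: "\<And>\<sigma>. \<sigma> \<in> real_embeddings K \<Longrightarrow> signature K \<eta>1 \<sigma> = k * signature K \<eta>2 \<sigma>"
    by blast
  show "\<exists>c. \<forall>\<sigma>\<in>real_embeddings K. s \<sigma> = (\<Sum>j<2. c j * g j \<sigma>)" if s: "s \<in> signature K ` units_of_field K" for s
  proof -
    obtain u where u: "u \<in> units_of_field K" "s = signature K u" using s by auto
    obtain k0 k1 k2 where "\<And>\<sigma>. \<sigma> \<in> real_embeddings K \<Longrightarrow>
      signature K u \<sigma> = k0 * signature K (- 1) \<sigma> + k1 * signature K \<eta>1 \<sigma> + k2 * signature K \<eta>2 \<sigma>"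
      using signature_unit[OF u(1)] by blast
    hence "s \<sigma> = k0 * signature K (- 1) \<sigma> + (k1 * k + k2) * signature K \<eta>2 \<sigma>" if "\<sigma> \<in> real_embeddings K" for \<sigma>
      using that k[OF that] unfolding u(2) by (simp only: ring_distribs mult.assoc add.assoc)
    thus ?thesis
      unfolding sum_lessThan_2 g
      by (intro exI[of _ "\<lambda>i. if i = 0 then k0 else k1 * k + k2"]) simp
  qed
qed

end

theorem theorem5p2:
  fixes q1 q2 :: nat and \<epsilon>1 \<epsilon>2 \<epsilon>3 :: real
  assumes "prime q1" and "prime q2" and "q1 \<noteq> q2"
    and "q1 mod 4 = 3" and "q2 mod 4 = 3"
    and "is_fundamental_unit (real q1) \<epsilon>1"
    and "is_fundamental_unit (real q2) \<epsilon>2"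
    and "is_fundamental_unit (real (q1 * q2)) \<epsilon>3"
  shows "sqrt (\<epsilon>1 * \<epsilon>2) \<in> biquad_field (real q1) (real q2) \<and>
         sqrt \<epsilon>3 \<in> biquad_field (real q1) (real q2) \<and>
         is_fundamental_system (biquad_field (real q1) (real q2)) [sqrt (\<epsilon>1 * \<epsilon>2), sqrt \<epsilon>3, \<epsilon>2] \<and>
         (q1 mod 8 = 3 \<and> q2 mod 8 = 3 \<longrightarrow>
            unit_signature_rank (biquad_field (real q1) (real q2)) = 3 \<and>
            deficiency (biquad_field (real q1) (real q2)) = 1) \<and>
         (q1 mod 8 = 7 \<and> q2 mod 8 = 7 \<longrightarrow>
            unit_signature_rank (biquad_field (real q1) (real q2)) = 2 \<and>
            deficiency (biquad_field (real q1) (real q2)) = 2) \<and>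
         (q1 mod 8 = 7 \<and> q2 mod 8 = 3 \<longrightarrow>
            (Legendre (int q1) (int q2) = 1 \<longrightarrow>
               unit_signature_rank (biquad_field (real q1) (real q2)) = 3 \<and>
               deficiency (biquad_field (real q1) (real q2)) = 1) \<and>
            (Legendre (int q1) (int q2) = -1 \<longrightarrow>
               unit_signature_rank (biquad_field (real q1) (real q2)) = 2 \<and>
               deficiency (biquad_field (real q1) (real q2)) = 2))"
proof -
  note p1 = assms(1,4) and p2 = assms(2,5)
  \<comment> \<open>Half the right-hand sides supplied by
    \<open>fundamental_unit_prime\<close>.\<close>
  define \<delta>1 \<delta>2 :: int where "\<delta>1 = (if q1 mod 8 = 7 then 1 else - 1)" and "\<delta>2 = (if q2 mod 8 = 7 then 1 else - 1)"
  obtain r1 t1 where 1: "r1 > 0" "t1 > 0" "\<epsilon>1 = (real r1 + real t1 * sqrt (real q1)) ^ 2 / 2"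
      "int r1 ^ 2 - int q1 * int t1 ^ 2 = (if q1 mod 8 = 7 then 2 else - 2)"
    by (rule fundamental_unit_prime[OF p1 assms(6)])
  obtain r2 t2 where 2: "r2 > 0" "t2 > 0" "\<epsilon>2 = (real r2 + real t2 * sqrt (real q2)) ^ 2 / 2"
      "int r2 ^ 2 - int q2 * int t2 ^ 2 = (if q2 mod 8 = 7 then 2 else - 2)"
    by (rule fundamental_unit_prime[OF p2 assms(7)])
  obtain r3 t3 where 3: "\<epsilon>3 = ((real r3 * sqrt (real q1) + real t3 * sqrt (real q2)) / 2) ^ 2"
      "\<bar>int q1 * int r3 ^ 2 - int q2 * int t3 ^ 2\<bar> = 4"
    by (rule fundamental_unit_two_primes[OF p1 p2 assms(3,8)])
  define \<tau> where "\<tau> = sgn (int q1 * int r3 ^ 2 - int q2 * int t3 ^ 2)"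
  have \<tau>: "int q1 * int r3 ^ 2 - int q2 * int t3 ^ 2 = 4 * \<tau>" "\<bar>\<tau>\<bar> = 1"
    using 3(2) by (auto simp: \<tau>_def abs_if sgn_if split: if_splits)
  interpret biquad_units q1 q2 \<epsilon>1 \<epsilon>2 \<epsilon>3 r1 t1 r2 t2 r3 t3 \<delta>1 \<delta>2 \<tau>
  proof unfold_locales
    show "odd q1" "odd q2" using assms(4,5) by presburger+
    show "int r1 ^ 2 - int q1 * int t1 ^ 2 = 2 * \<delta>1" "int r2 ^ 2 - int q2 * int t2 ^ 2 = 2 * \<delta>2"
      "\<bar>\<delta>1\<bar> = 1" "\<bar>\<delta>2\<bar> = 1"
      using 1(4) 2(4) by (simp_all add: \<delta>1_def \<delta>2_def)
  qed (fact assms 1 2 3 \<tau>)+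
  have rank3: "unit_signature_rank K = 3 \<and> deficiency K = 1" if "\<delta>2 = - 1" "\<delta>1 = - 1 \<or> \<tau> = 1"
    using unit_signature_rank_3[OF that] by (simp add: deficiency_def card_real_embeddings)
  have rank2: "unit_signature_rank K = 2 \<and> deficiency K = 2" if "\<delta>1 = 1" "\<delta>2 = 1 \<or> \<tau> = - 1"
    using unit_signature_rank_2[OF that] by (simp add: deficiency_def card_real_embeddings)
  \<comment> \<open>When \<open>q1 mod 8 = 7\<close> and \<open>q2 mod 8 = 3\<close>, we have
    \<open>\<delta>1 = 1\<close> and \<open>\<delta>2 = - 1\<close>, so the rank depends on
    \<open>\<tau>\<close>, which the Legendre symbol determines.\<close>
  have "\<tau> = 1 \<or> \<tau> = - 1" using \<tau>(2) by linarith
  hence Leg: "Legendre (int q1) (int q2) = 1 \<Longrightarrow> \<tau> = 1" "Legendre (int q1) (int q2) = - 1 \<Longrightarrow> \<tau> = - 1"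
    using Legendre_from_norm_equation[OF p2 \<tau>(1)] by blast+
  show ?thesis
    unfolding sqrt_eq
    by (intro conjI[OF \<eta>_in_K(1)] conjI[OF \<eta>_in_K(2)] conjI[OF fundamental_system] conjI impI)
       (use rank2 rank3 Leg in \<open>simp_all add: \<delta>1_def \<delta>2_def\<close>)
qed

end
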